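(* Fix $p\in(0,1)$. There is a constant $C>0$, not depending on $l,j$ (nor on $\mu,f,g$), such that the following holds. Let $l,j\ge 0$ be integers, let $k=(l+j)/2$, and let $\mu$ be a measure on $\mathbb{D}$ with $\mu\in\mathfrak{M}_{k}$. Then the sesquilinear form $$F_{\mu,l,j}(f,g)=\int_{\mathbb{D}}\partial^l f(z)\,\overline{\partial^j g(z)}\,d\mu(z),\qquad f,g\in\mathcal{A}^2(\mathbb{D}),$$ is bounded on $\mathcal{A}^2(\mathbb{D})$ and $$|F_{\mu,l,j}(f,g)|\le C\,M_{l,k}^{1/2}M_{j,k}^{1/2}\,\varpi_k(\mu)\,\|f\|\,\|g\|\quad\text{for all } f,g\in\mathcal{A}^2(\mathbb{D}).$$
   Context: $\mathbb{D}$ is the open unit disk in $\mathbb{C}$, and $\mathcal{A}^2(\mathbb{D})$ is the Bergman space of analytic functions on $\mathbb{D}$ square integrable with respect to the normalized Lebesgue measure $dV=\pi^{-1}dx\,dy$, with norm $\|\cdot\|$. $\partial^l f=f^{(l)}$ is the $l$-th complex derivative. $\mathbf{D}(z,R)$ is the Euclidean disk with center $z$ and radius $R$. Measures are complex Borel measures on $\mathbb{D}$ whose variation $|\mu|$ is finite on compact subsets of $\mathbb{D}$. For an integer or half-integer $k\ge 0$ (i.e. $2k\in\mathbb{Z}_{\ge 0}$), the class $\mathfrak{M}_k=\mathfrak{M}_{k,p}$ consists of the measures $\mu$ on $\mathbb{D}$ with $$\varpi_k(\mu)=\varpi_{k,p}(\mu):=\sup_{z\in\mathbb{D}}\left\{|\mu|\left(\mathbf{D}(z,\tfrac12(1-|z|))\right)(1-|z|)^{-2(k+1)}\,\Gamma(k+1)^2\,p^{-2k}\right\}<\infty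 .$$ For integers or half-integers $l,k\ge0$, $M_{l,k}=p^{2(k-l)}\left(\Gamma(l+1)/\Gamma(k+1)\right)^2$. *)

theory Defs
  imports "HOL-Analysis.Analysis"
begin

abbreviation unit_disk :: "complex set" where
  "unit_disk \<equiv> ball 0 1"

text \<open>Elements are functions on the whole plane, but only their values on the disk matter.\<close>

definition bergman_space :: "(complex \<Rightarrow> complex) set" where
  "bergman_space = {f. f holomorphic_on unit_disk \<and>
     set_integrable lborel unit_disk (\<lambda>z. (norm (f z))\<^sup>2)}"

text \<open>The factor \<open>1 / pi\<close> comes from the normalized area measure.\<close>

definition bergman_norm :: "(complex \<Rightarrow> complex) \<Rightarrow> real" where
  "bergman_norm f = sqrt ((1 / pi) * (LINT z:unit_disk|lborel. (norm (f z))\<^sup>2))"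

text \<open>
  The measures have finite variation on compact subsets of the disk, but their total variation
  may be infinite. Such a measure is encoded as a set function that is defined and countably additive on the Borel sets contained in a compact subset of the disk.
  The values on all other sets are irrelevant.
\<close>

definition local_sets :: "complex set set" where
  "local_sets = {A \<in> sets borel. \<exists>K. compact K \<and> K \<subseteq> unit_disk \<and> A \<subseteq> K}"

abbreviation borel_disk :: "complex set set" where
  "borel_disk \<equiv> sets (restrict_space borel unit_disk)"

text \<open>
  Every finite disjoint family of subsets of \<open>E\<close> extends to a countable Borel partition
  of \<open>E\<close>, so this is the usual supremum over countable partitions.
\<close>

definition variation :: "(complex set \<Rightarrow> complex) \<Rightarrow> complex set \<Rightarrow> ennreal" where
  "variation \<mu> E =
     (SUP P \<in> {P. finite P \<and> disjoint P \<and> P \<subseteq> local_sets \<and> \<Union>P \<subseteq> E}.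
        \<Sum>A\<in>P. ennreal (norm (\<mu> A)))"

definition locally_additive :: "(complex set \<Rightarrow> 'a::real_normed_vector) \<Rightarrow> bool" where
  "locally_additive \<phi> \<longleftrightarrow>
     (\<forall>A::nat \<Rightarrow> complex set. disjoint_family A \<and> range A \<subseteq> local_sets \<and>
        (\<Union>n. A n) \<in> local_sets \<longrightarrow> (\<lambda>n. \<phi> (A n)) sums \<phi> (\<Union>n. A n))"

definition disk_measure :: "(complex set \<Rightarrow> complex) \<Rightarrow> bool" where
  "disk_measure \<mu> \<longleftrightarrow>
     locally_additive \<mu> \<and> (\<forall>K. compact K \<and> K \<subseteq> unit_disk \<longrightarrow> variation \<mu> K < \<infinity>)"

definition variation_measure :: "(complex set \<Rightarrow> complex) \<Rightarrow> complex measure" where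
  "variation_measure \<mu> = measure_of unit_disk borel_disk (variation \<mu>)"

text \<open>
  Integration against a complex measure is defined by the Jordan decompositions of its real
  and imaginary parts. The positive part of a real set function is its upper variation; the
  negative part is the positive part of its negation. Negative values are cut off at 0 by
  \<^const>\<open>ennreal\<close>, in accordance with the admissible choice of the empty set.
\<close>

definition upper_variation :: "(complex set \<Rightarrow> real) \<Rightarrow> complex set \<Rightarrow> ennreal" where
  "upper_variation \<nu> E = (SUP A \<in> {A \<in> local_sets. A \<subseteq> E}. ennreal (\<nu> A))"

definition positive_part :: "(complex set \<Rightarrow> real) \<Rightarrow> complex measure" where
  "positive_part \<nu> = measure_of unit_disk borel_disk (upper_variation \<nu>)"

definition complex_integral ::
    "(complex set \<Rightarrow> complex) \<Rightarrow> (complex \<Rightarrow> complex) \<Rightarrow> complex" where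
  "complex_integral \<mu> h =
     (LINT z|positive_part (\<lambda>A. Re (\<mu> A)). h z)
     - (LINT z|positive_part (\<lambda>A. - Re (\<mu> A)). h z)
     + \<i> * ((LINT z|positive_part (\<lambda>A. Im (\<mu> A)). h z)
          - (LINT z|positive_part (\<lambda>A. - Im (\<mu> A)). h z))"

text \<open>
  If the set function given to \<^const>\<open>measure_of\<close> were not a measure, the result would be the
  zero measure. The facts \<open>emeasure_variation_measure\<close> and \<open>emeasure_positive_part\<close> show that
  this does not happen for the set functions in question.
\<close>

lemma sigma_algebra_borel_disk: "sigma_algebra unit_disk borel_disk"
  using sets.sigma_algebra_axioms[of "restrict_space borel unit_disk"]
  by (simp add: space_restrict_space)

lemma borel_disk_borel: "E \<in> borel_disk \<Longrightarrow> E \<in> sets borel"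
  by (auto simp: sets_restrict_space)

lemma local_sets_Int: "A \<in> local_sets \<Longrightarrow> E \<in> sets borel \<Longrightarrow> A \<inter> E \<in> local_sets"
  by (auto simp: local_sets_def)

lemma empty_local_sets [simp]: "{} \<in> local_sets"
  by (auto simp: local_sets_def)

lemma locally_additiveD:
  assumes "locally_additive \<phi>" "disjoint_family A" "range A \<subseteq> local_sets"
    "(\<Union>n::nat. A n) \<in> local_sets"
  shows "(\<lambda>n. \<phi> (A n)) sums \<phi> (\<Union>n. A n)"
  using assms unfolding locally_additive_def by blast

lemma local_sums:
  assumes add: "locally_additive \<phi>"
    and E: "range E \<subseteq> borel_disk" "disjoint_family E"
    and B: "B \<in> local_sets" "B \<subseteq> (\<Union>i. E i)"
  shows "(\<lambda>n::nat. \<phi> (B \<inter> E n)) sums \<phi> B"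
proof -
  have eq: "(\<Union>n. B \<inter> E n) = B"
    using B by auto
  have "(\<lambda>n. \<phi> (B \<inter> E n)) sums \<phi> (\<Union>n. B \<inter> E n)"
  proof (rule locally_additiveD[OF add])
    show "disjoint_family (\<lambda>n. B \<inter> E n)"
      using E(2) by (auto simp: disjoint_family_on_def)
    show "range (\<lambda>n. B \<inter> E n) \<subseteq> local_sets"
      using E(1) B(1) by (auto intro!: local_sets_Int borel_disk_borel)
    show "(\<Union>n. B \<inter> E n) \<in> local_sets"
      using B eq by simp
  qed
  then show ?thesis
    by (simp only: eq)
qed

lemma local_empty:
  fixes \<phi> :: "complex set \<Rightarrow> 'a::real_normed_vector"
  assumes add: "locally_additive \<phi>"
  shows "\<phi> {} = 0"
proof -
  have "(\<lambda>n::nat. \<phi> {}) sums \<phi> {}"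
    using locally_additiveD[OF add, of "\<lambda>_. {}"] by (simp add: disjoint_family_on_def)
  then show ?thesis
    using sums_summable summable_const_iff by blast
qed

lemma measure_space_disk:
  fixes f :: "complex set \<Rightarrow> ennreal"
  assumes zero: "f {} = 0"
    and mono: "\<And>A B. A \<subseteq> B \<Longrightarrow> f A \<le> f B"
    and super: "\<And>A B. A \<inter> B = {} \<Longrightarrow> f A + f B \<le> f (A \<union> B)"
    and sub: "\<And>A::nat \<Rightarrow> complex set. range A \<subseteq> borel_disk \<Longrightarrow> disjoint_family A \<Longrightarrow>
      f (\<Union>i. A i) \<le> (\<Sum>i. f (A i))"
  shows "measure_space unit_disk borel_disk f"
proof -
  have "positive borel_disk f"
    by (simp add: positive_def zero)
  moreover have "countably_additive borel_disk f"
    unfolding countably_additive_def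
  proof (intro allI impI)
    fix A :: "nat \<Rightarrow> complex set"
    assume A: "range A \<subseteq> borel_disk" "disjoint_family A" "(\<Union>i. A i) \<in> borel_disk"
    have fin: "(\<Sum>i<n. f (A i)) \<le> f (\<Union>i<n. A i)" for n
    proof (induction n)
      case (Suc n)
      have "(\<Union>i<n. A i) \<inter> A n = {}"
      proof -
        have "A i \<inter> A n = {}" if "i < n" for i
          using A(2) that by (simp add: disjoint_family_on_def)
        then show ?thesis
          by blast
      qed
      then have "f (\<Union>i<n. A i) + f (A n) \<le> f ((\<Union>i<n. A i) \<union> A n)"
        by (rule super)
      also have "(\<Union>i<n. A i) \<union> A n = (\<Union>i<Suc n. A i)"
        by (auto simp: less_Suc_eq)
      finally show ?case
        using order_trans[OF add_right_mono[OF Suc.IH, of "f (A n)"]] by (simp only: sum.lessThan_Suc)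
    qed (simp add: zero)
    have "(\<Sum>i. f (A i)) \<le> f (\<Union>i. A i)"
      unfolding suminf_eq_SUP
    proof (rule SUP_least)
      fix n
      have "(\<Union>i<n. A i) \<subseteq> (\<Union>i. A i)"
        by blast
      then show "(\<Sum>i<n. f (A i)) \<le> f (\<Union>i. A i)"
        using fin order_trans mono by blast
    qed
    then show "(\<Sum>i. f (A i)) = f (\<Union>i. A i)"
      using sub[OF A(1,2)] by (rule antisym)
  qed
  ultimately show ?thesis
    using sigma_algebra_borel_disk by (simp only: measure_space_def simp_thms)
qed

lemma emeasure_disk:
  assumes "measure_space unit_disk borel_disk f" "E \<in> borel_disk"
  shows "emeasure (measure_of unit_disk borel_disk f) E = f E"
  by (rule emeasure_measure_of_sigma) (use assms in \<open>simp_all only: measure_space_def\<close>)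

lemma emeasure_variation_measure:
  assumes "disk_measure \<mu>" "E \<in> borel_disk"
  shows "emeasure (variation_measure \<mu>) E = variation \<mu> E"
proof -
  let ?F = "\<lambda>E. {P. finite P \<and> disjoint P \<and> P \<subseteq> local_sets \<and> \<Union>P \<subseteq> E}"
  let ?s = "\<lambda>P. \<Sum>A\<in>P. ennreal (norm (\<mu> A))"
  have add: "locally_additive \<mu>"
    using assms(1) by (simp add: disk_measure_def)
  note empty = local_empty[OF add]
  have ms: "measure_space unit_disk borel_disk (variation \<mu>)"
  proof (rule measure_space_disk)
    have "?s P = 0" if "P \<in> ?F {}" for P
      using that empty by (intro sum.neutral) auto
    then have "variation \<mu> {} \<le> 0"
      unfolding variation_def by (intro SUP_least) simp
    then show "variation \<mu> {} = 0"
      by simp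
  next
    fix A B :: "complex set" assume "A \<subseteq> B"
    then show "variation \<mu> A \<le> variation \<mu> B"
      unfolding variation_def by (intro SUP_subset_mono) auto
  next
    fix A B :: "complex set" assume AB: "A \<inter> B = {}"
    have key: "?s P + ?s Q \<le> variation \<mu> (A \<union> B)" if P: "P \<in> ?F A" and Q: "Q \<in> ?F B" for P Q
    proof -
      have "?s P + ?s Q = ?s (P \<union> Q)"
      proof (rule sum.union_inter_neutral[symmetric])
        have "X = {}" if "X \<in> P \<inter> Q" for X
          using that P Q AB by blast
        then show "\<forall>X\<in>P \<inter> Q. ennreal (norm (\<mu> X)) = 0"
          using empty by (metis ennreal_0 norm_zero)
      qed (use P Q in auto)
      also have "\<dots> \<le> variation \<mu> (A \<union> B)"
        unfolding variation_def
      proof (rule SUP_upper)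
        have "\<Union>P \<inter> \<Union>Q = {}"
          using P Q AB by blast
        then have "disjoint (P \<union> Q)"
          using P Q by (intro disjoint_union) auto
        then show "P \<union> Q \<in> ?F (A \<union> B)"
          using P Q by auto
      qed
      finally show ?thesis .
    qed
    have ne: "?F A \<noteq> {}" "?F B \<noteq> {}"
      by (auto intro!: exI[of _ "{}"])
    have "variation \<mu> A + variation \<mu> B = (SUP P\<in>?F A. ?s P + variation \<mu> B)"
      unfolding variation_def[of \<mu> A] using ne by (subst ennreal_SUP_add_left) auto
    also have "\<dots> = (SUP P\<in>?F A. SUP Q\<in>?F B. ?s P + ?s Q)"
      unfolding variation_def[of \<mu> B] using ne
      by (intro SUP_cong refl, subst ennreal_SUP_add_right) auto
    also have "\<dots> \<le> variation \<mu> (A \<union> B)"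
      by (intro SUP_least key)
    finally show "variation \<mu> A + variation \<mu> B \<le> variation \<mu> (A \<union> B)" .
  next
    fix E :: "nat \<Rightarrow> complex set"
    assume E: "range E \<subseteq> borel_disk" "disjoint_family E"
    show "variation \<mu> (\<Union>i. E i) \<le> (\<Sum>i. variation \<mu> (E i))"
      unfolding variation_def[of \<mu> "\<Union>i. E i"]
    proof (rule SUP_least)
      fix P assume P: "P \<in> ?F (\<Union>i. E i)"
      have one: "ennreal (norm (\<mu> A)) \<le> (\<Sum>i. ennreal (norm (\<mu> (A \<inter> E i))))" if "A \<in> P" for A
      proof -
        have s: "(\<lambda>i. \<mu> (A \<inter> E i)) sums \<mu> A"
          using P that by (intro local_sums[OF add E]) auto
        have "(\<lambda>n. ennreal (norm (\<Sum>i<n. \<mu> (A \<inter> E i)))) \<longlonglongrightarrow> ennreal (norm (\<mu> A))"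
          using s unfolding sums_def by (intro tendsto_ennrealI tendsto_norm)
        then show ?thesis
        proof (rule LIMSEQ_le_const2, intro exI allI impI)
          fix n
          have "ennreal (norm (\<Sum>i<n. \<mu> (A \<inter> E i))) \<le> (\<Sum>i<n. ennreal (norm (\<mu> (A \<inter> E i))))"
            by (simp add: norm_sum ennreal_leI)
          also have "\<dots> \<le> (\<Sum>i. ennreal (norm (\<mu> (A \<inter> E i))))"
            by (intro sum_le_suminf) auto
          finally show "ennreal (norm (\<Sum>i<n. \<mu> (A \<inter> E i))) \<le> \<dots>" .
        qed
      qed
      have two: "(\<Sum>A\<in>P. ennreal (norm (\<mu> (A \<inter> E i)))) \<le> variation \<mu> (E i)" for i
      proof -
        have "?s ((\<lambda>A. A \<inter> E i) ` P) = (\<Sum>A\<in>P. ennreal (norm (\<mu> (A \<inter> E i))))"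
        proof (rule sum.reindex_nontrivial[where g="\<lambda>A. ennreal (norm (\<mu> A))", unfolded comp_def])
          show "finite P"
            using P by simp
          fix A B assume h: "A \<in> P" "B \<in> P" "A \<noteq> B" "A \<inter> E i = B \<inter> E i"
          then have "A \<inter> B = {}"
            using P by (auto dest: disjointD)
          then have "A \<inter> E i = {}"
            using h by auto
          then show "ennreal (norm (\<mu> (A \<inter> E i))) = 0"
            using empty by simp
        qed
        moreover have "(\<lambda>A. A \<inter> E i) ` P \<in> ?F (E i)"
        proof -
          have "disjoint ((\<lambda>A. A \<inter> E i) ` P)"
          proof (rule disjointI)
            fix X Y assume "X \<in> (\<lambda>A. A \<inter> E i) ` P" "Y \<in> (\<lambda>A. A \<inter> E i) ` P" "X \<noteq> Y"
            then obtain A B where AB: "A \<in> P" "B \<in> P" "A \<noteq> B" "X = A \<inter> E i" "Y = B \<inter> E i"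
              by blast
            then have "A \<inter> B = {}"
              using P by (auto dest: disjointD)
            then show "X \<inter> Y = {}"
              using AB by blast
          qed
          moreover have "(\<lambda>A. A \<inter> E i) ` P \<subseteq> local_sets"
            using P E(1) by (auto intro!: local_sets_Int borel_disk_borel)
          ultimately show ?thesis
            using P by auto
        qed
        ultimately show ?thesis
          unfolding variation_def by (metis (mono_tags, lifting) SUP_upper)
      qed
      have "?s P \<le> (\<Sum>A\<in>P. \<Sum>i. ennreal (norm (\<mu> (A \<inter> E i))))"
        by (intro sum_mono one)
      also have "\<dots> = (\<Sum>i. \<Sum>A\<in>P. ennreal (norm (\<mu> (A \<inter> E i))))"
        by (intro suminf_sum[symmetric] summableI)
      also have "\<dots> \<le> (\<Sum>i. variation \<mu> (E i))"
        by (intro suminf_le two summableI)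
      finally show "?s P \<le> (\<Sum>i. variation \<mu> (E i))" .
    qed
  qed
  then show ?thesis
    unfolding variation_measure_def using assms(2) by (rule emeasure_disk)
qed

lemma emeasure_positive_part:
  assumes add: "locally_additive \<nu>"
    and "E \<in> borel_disk"
  shows "emeasure (positive_part \<nu>) E = upper_variation \<nu> E"
proof -
  let ?F = "\<lambda>E. {A \<in> local_sets. A \<subseteq> E}"
  have empty: "\<nu> {} = 0"
    by (rule local_empty[OF add])
  have ms: "measure_space unit_disk borel_disk (upper_variation \<nu>)"
  proof (rule measure_space_disk)
    have "?F {} = {{}}"
      by auto
    then show "upper_variation \<nu> {} = 0"
      unfolding upper_variation_def by (simp add: empty)
  next
    fix A B :: "complex set" assume "A \<subseteq> B"
    then show "upper_variation \<nu> A \<le> upper_variation \<nu> B"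
      unfolding upper_variation_def by (intro SUP_subset_mono) auto
  next
    fix A B :: "complex set" assume AB: "A \<inter> B = {}"
    have key: "ennreal (\<nu> X) + ennreal (\<nu> Y) \<le> upper_variation \<nu> (A \<union> B)"
      if X: "X \<in> ?F A" and Y: "Y \<in> ?F B" for X Y
    proof -
      have up: "ennreal (\<nu> Z) \<le> upper_variation \<nu> (A \<union> B)" if "Z \<in> ?F (A \<union> B)" for Z
        using that unfolding upper_variation_def by (rule SUP_upper)
      show ?thesis
      proof (cases "\<nu> X \<ge> 0 \<and> \<nu> Y \<ge> 0")
        case True
        obtain K L where KL: "compact K" "K \<subseteq> unit_disk" "X \<subseteq> K" "compact L" "L \<subseteq> unit_disk" "Y \<subseteq> L"
          using X Y unfolding local_sets_def by blast
        have b: "X \<in> sets borel" "Y \<in> sets borel"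
          using X Y by (auto simp: local_sets_def)
        have "compact (K \<union> L)" "K \<union> L \<subseteq> unit_disk" "X \<union> Y \<subseteq> K \<union> L"
          using KL by auto
        then have XY: "X \<union> Y \<in> local_sets"
          using b unfolding local_sets_def by blast
        have "(\<lambda>n. \<nu> (binaryset X Y n)) sums \<nu> (\<Union>n. binaryset X Y n)"
        proof (rule locally_additiveD[OF add])
          show "disjoint_family (binaryset X Y)"
            using X Y AB by (auto simp: disjoint_family_on_def binaryset_def)
          show "range (binaryset X Y) \<subseteq> local_sets"
            using X Y by (auto simp: range_binaryset_eq)
        qed (simp add: UN_binaryset_eq XY)
        moreover have "(\<lambda>n. \<nu> (binaryset X Y n)) sums (\<nu> X + \<nu> Y)"
          by (rule binaryset_sums) (rule empty)
        ultimately have "\<nu> (X \<union> Y) = \<nu> X + \<nu> Y"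
          by (simp add: UN_binaryset_eq sums_iff)
        then have "ennreal (\<nu> X) + ennreal (\<nu> Y) = ennreal (\<nu> (X \<union> Y))"
          using True by simp
        also have "\<dots> \<le> upper_variation \<nu> (A \<union> B)"
          using X Y XY by (intro up) auto
        finally show ?thesis .
      next
        case False
        then consider "ennreal (\<nu> X) = 0" | "ennreal (\<nu> Y) = 0"
          by (auto simp: ennreal_eq_0_iff)
        then show ?thesis
        proof cases
          case 1
          then show ?thesis using up[of Y] Y by auto
        next
          case 2
          then show ?thesis using up[of X] X by auto
        qed
      qed
    qed
    have ne: "?F A \<noteq> {}" "?F B \<noteq> {}"
      by (auto intro!: exI[of _ "{}"])
    have "upper_variation \<nu> A + upper_variation \<nu> B =
        (SUP X\<in>?F A. ennreal (\<nu> X) + upper_variation \<nu> B)"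
      unfolding upper_variation_def[of \<nu> A] using ne by (subst ennreal_SUP_add_left) auto
    also have "\<dots> = (SUP X\<in>?F A. SUP Y\<in>?F B. ennreal (\<nu> X) + ennreal (\<nu> Y))"
      unfolding upper_variation_def[of \<nu> B] using ne
      by (intro SUP_cong refl, subst ennreal_SUP_add_right) auto
    also have "\<dots> \<le> upper_variation \<nu> (A \<union> B)"
      by (intro SUP_least key)
    finally show "upper_variation \<nu> A + upper_variation \<nu> B \<le> upper_variation \<nu> (A \<union> B)" .
  next
    fix E :: "nat \<Rightarrow> complex set"
    assume E: "range E \<subseteq> borel_disk" "disjoint_family E"
    show "upper_variation \<nu> (\<Union>i. E i) \<le> (\<Sum>i. upper_variation \<nu> (E i))"
      unfolding upper_variation_def[of \<nu> "\<Union>i. E i"]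
    proof (rule SUP_least)
      fix A assume A: "A \<in> ?F (\<Union>i. E i)"
      have s: "(\<lambda>i. \<nu> (A \<inter> E i)) sums \<nu> A"
        using A by (intro local_sums[OF add E]) auto
      have "(\<lambda>n. ennreal (\<Sum>i<n. \<nu> (A \<inter> E i))) \<longlonglongrightarrow> ennreal (\<nu> A)"
        using s unfolding sums_def by (intro tendsto_ennrealI)
      then show "ennreal (\<nu> A) \<le> (\<Sum>i. upper_variation \<nu> (E i))"
      proof (rule LIMSEQ_le_const2, intro exI allI impI)
        fix n
        have "ennreal (\<Sum>i<n. \<nu> (A \<inter> E i)) \<le> ennreal (\<Sum>i<n. max 0 (\<nu> (A \<inter> E i)))"
          by (intro ennreal_leI sum_mono) auto
        also have "\<dots> = (\<Sum>i<n. ennreal (max 0 (\<nu> (A \<inter> E i))))"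
          by (rule sum_ennreal[symmetric]) auto
        also have "\<dots> \<le> (\<Sum>i<n. upper_variation \<nu> (E i))"
        proof (rule sum_mono)
          fix i
          have "A \<inter> E i \<in> ?F (E i)"
            using A E(1) by (auto intro!: local_sets_Int borel_disk_borel)
          then have "ennreal (\<nu> (A \<inter> E i)) \<le> upper_variation \<nu> (E i)"
            unfolding upper_variation_def by (rule SUP_upper)
          then show "ennreal (max 0 (\<nu> (A \<inter> E i))) \<le> upper_variation \<nu> (E i)"
            by (auto simp: max_def)
        qed
        also have "\<dots> \<le> (\<Sum>i. upper_variation \<nu> (E i))"
          by (intro sum_le_suminf) auto
        finally show "ennreal (\<Sum>i<n. \<nu> (A \<inter> E i)) \<le> \<dots>" .
      qed
    qed
  qed
  then show ?thesis
    unfolding positive_part_def using assms(2) by (rule emeasure_disk)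
qed

text \<open>
  The parameter \<open>k\<close> is meant to be a nonnegative integer or half-integer. The bases of all real
  powers are positive for \<open>0 < p\<close> and \<open>z\<close> in the disk.
\<close>

definition carleson_sup :: "real \<Rightarrow> real \<Rightarrow> (complex set \<Rightarrow> complex) \<Rightarrow> ennreal" where
  "carleson_sup p k \<mu> =
     (SUP z \<in> unit_disk. variation \<mu> (ball z ((1 / 2) * (1 - norm z))) *
        ennreal ((1 - norm z) powr (- 2 * (k + 1)) * (Gamma (k + 1))\<^sup>2 * p powr (- 2 * k)))"

definition carleson_class :: "real \<Rightarrow> real \<Rightarrow> (complex set \<Rightarrow> complex) set" where
  "carleson_class p k = {\<mu>. disk_measure \<mu> \<and> carleson_sup p k \<mu> < \<infinity>}"

definition M_const :: "real \<Rightarrow> real \<Rightarrow> real \<Rightarrow> real" where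
  "M_const p l k = p powr (2 * (k - l)) * (Gamma (l + 1) / Gamma (k + 1))\<^sup>2"

definition form_integrand ::
    "nat \<Rightarrow> nat \<Rightarrow> (complex \<Rightarrow> complex) \<Rightarrow> (complex \<Rightarrow> complex) \<Rightarrow> complex \<Rightarrow> complex" where
  "form_integrand l j f g z = (deriv ^^ l) f z * cnj ((deriv ^^ j) g z)"

definition sesq_form ::
    "(complex set \<Rightarrow> complex) \<Rightarrow> nat \<Rightarrow> nat \<Rightarrow> (complex \<Rightarrow> complex) \<Rightarrow> (complex \<Rightarrow> complex) \<Rightarrow> complex"
  where "sesq_form \<mu> l j f g = complex_integral \<mu> (form_integrand l j f g)"

definition sesquilinear_on_bergman ::
    "((complex \<Rightarrow> complex) \<Rightarrow> (complex \<Rightarrow> complex) \<Rightarrow> complex) \<Rightarrow> bool" where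
  "sesquilinear_on_bergman F \<longleftrightarrow>
     (\<forall>f1\<in>bergman_space. \<forall>f2\<in>bergman_space. \<forall>g\<in>bergman_space. \<forall>a b.
        F (\<lambda>z. a * f1 z + b * f2 z) g = a * F f1 g + b * F f2 g) \<and>
     (\<forall>f\<in>bergman_space. \<forall>g1\<in>bergman_space. \<forall>g2\<in>bergman_space. \<forall>a b.
        F f (\<lambda>z. a * g1 z + b * g2 z) = cnj a * F f g1 + cnj b * F f g2)"

definition bounded_on_bergman ::
    "((complex \<Rightarrow> complex) \<Rightarrow> (complex \<Rightarrow> complex) \<Rightarrow> complex) \<Rightarrow> bool" where
  "bounded_on_bergman F \<longleftrightarrow>
     (\<exists>B. \<forall>f\<in>bergman_space. \<forall>g\<in>bergman_space.
        norm (F f g) \<le> B * bergman_norm f * bergman_norm g)"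

end

theory Submission
  imports Defs "HOL-Complex_Analysis.Cauchy_Integral_Formula"
begin

text \<open>
  Write \<open>m = 1 - |w|\<close> and \<open>2 * k = l + j\<close>. The Carleson condition says that the disk of radius
  \<open>m / 2\<close> about \<open>w\<close> has variation at most \<open>V * (p * m)\<^bsup>l+j\<^esup> * m\<^sup>2 / Gamma(k+1)\<^sup>2\<close>, where \<open>V\<close> is the
  supremum defining the class. On the other side the Cauchy inequality on a circle of radius
  \<open>p * m\<close> bounds the derivatives of orders \<open>l\<close> and \<open>j\<close> near \<open>w\<close> by \<open>l! / (p * m)\<^sup>l\<close> and \<open>j! / (p * m)\<^sup>j\<close>
  times the supremum of the function on a slightly larger disk. The powers of \<open>p * m\<close> cancel, and
  \<open>l! * j! / Gamma(k+1)\<^sup>2\<close> is the product of the square roots of the two constants \<open>M\<close>.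

  The point is that nothing exponential in \<open>l\<close> or \<open>j\<close> may be lost. Suprema of holomorphic functions
  are bounded by square means over disks of relative radius \<open>d = (1 - p) / 4\<close>
  (\<open>area_submean_value\<close>), at a cost depending on \<open>p\<close> only. Moreover the estimates are anchored at
  \<open>w\<close>, for all points within \<open>d * m\<close> of \<open>w\<close> simultaneously
  (\<open>norm_higher_deriv_le_local_energy\<close>), so that the power of the boundary distance is
  the same in the derivative bounds and in the bound for the measure.

  The local estimates are summed without a covering: the measure is averaged against a kernel that
  sees from \<open>w\<close> the points within \<open>d * m\<close>, with weight \<open>1 / m\<^sup>2\<close>. By Tonelli the integral
  of \<open>|\<partial>\<^sup>l f| |\<partial>\<^sup>j g|\<close> becomes an area integral over \<open>w\<close>, which the Cauchy-Schwarz inequality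
  bounds by \<open>\<parallel>f\<parallel> \<parallel>g\<parallel>\<close>, since every point is seen from a set of bounded weight
  (\<open>carleson_derivative_embedding\<close>). The form itself is an integral against the four
  Jordan parts of the measure, each of which is dominated by the variation.
\<close>

section \<open>Area mean values of holomorphic functions\<close>

lemma circle_mean_value:
  assumes "continuous_on (cball 0 1) G" "G holomorphic_on ball 0 1"
  shows "((\<lambda>t. G (exp (2 * of_real pi * \<i> * of_real t))) has_integral G 0) {0..1::real}"
proof -
  have "((\<lambda>u. G u / (u - 0)) has_contour_integral (2 * of_real pi * \<i> * G 0)) (circlepath 0 1)"
    by (rule Cauchy_integral_circlepath) (use assms in auto)
  then have "((\<lambda>t. 2 * of_real pi * \<i> * G (exp (2 * of_real pi * \<i> * of_real t)))
      has_integral (2 * of_real pi * \<i> * G 0)) {0..1::real}"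
    unfolding has_contour_integral_def
    by (rule has_integral_eq[rotated]) (simp add: vector_derivative_circlepath01, simp add: circlepath)
  from has_integral_mult_right[OF this, of "1 / (2 * of_real pi * \<i>)"] show ?thesis
    by simp
qed

text \<open>
  The proof passes through \<open>real^2\<close>, where orthogonal maps preserve the measure of sets. The map \<open>v \<mapsto> d * \<phi> v\<close> from \<open>real^2\<close> to the complex plane is considered
  for all unimodular \<open>d\<close> at once: it pulls a box back to an orthogonal image of a box, and hence
  pushes area forward to area. The case \<open>d = 1\<close> identifies the two area measures, and comparison
  with \<open>d = c\<close> gives the rotation.
\<close>

lemma lborel_complex_distr_rotation:
  fixes c :: complex
  assumes "norm c = 1"
  shows "distr lborel borel ((*) c) = lborel"
proof -
  define \<phi> :: "real^2 \<Rightarrow> complex" where "\<phi> v = Complex (v $ 1) (v $ 2)" for v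
  define \<psi> :: "complex \<Rightarrow> real^2" where "\<psi> z = vector [Re z, Im z]" for z
  have \<phi>\<psi> [simp]: "\<phi> (\<psi> z) = z" "\<psi> (\<phi> v) = v" for z v
    by (simp_all add: \<phi>_def \<psi>_def vec_eq_iff forall_2)
  have \<phi>_lin: "linear \<phi>"
    by (rule linearI) (simp_all add: \<phi>_def complex_eq_iff)
  have \<psi>_lin: "linear \<psi>"
    by (rule linearI) (simp_all add: \<psi>_def vec_eq_iff forall_2)
  have norm\<phi>: "norm (\<phi> v) = norm v" for v
    by (simp add: \<phi>_def cmod_def norm_vec_def L2_set_def UNIV_2)
  have norm\<psi>: "norm (\<psi> z) = norm z" for z
    using norm\<phi>[of "\<psi> z"] by simp
  have box: "\<psi> z \<in> box (\<psi> l) (\<psi> u) \<longleftrightarrow> z \<in> box l u" for z l u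
    by (auto simp: \<psi>_def mem_box_cart forall_2 in_box_complex_iff)
  have key: "distr lborel borel (\<lambda>v. d * \<phi> v) = lborel" if d: "norm d = 1" for d
  proof (rule lborel_eqI[symmetric])
    have cont: "continuous_on UNIV (\<lambda>v. d * \<phi> v)"
      by (intro continuous_intros linear_continuous_on linear_conv_bounded_linear[THEN iffD1] \<phi>_lin)
    then have meas: "(\<lambda>v. d * \<phi> v) \<in> borel_measurable lborel"
      by (simp add: borel_measurable_continuous_onI)
    fix l u :: complex
    assume lu: "\<And>b. b \<in> Basis \<Longrightarrow> l \<bullet> b \<le> u \<bullet> b"
    then have le: "Re l \<le> Re u" "Im l \<le> Im u"
      using lu[of 1] lu[of \<i>] by (simp_all add: Basis_complex_def)
    define h where "h v = \<psi> (cnj d * \<phi> v)" for v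
    define S where "S = (\<lambda>v. d * \<phi> v) -` box l u"
    have dd: "cnj d * d = 1" "d * cnj d = 1"
      using d by (simp_all add: complex_norm_square[symmetric] mult.commute)
    have S: "S = h ` box (\<psi> l) (\<psi> u)"
    proof (intro set_eqI iffI)
      fix v assume "v \<in> S"
      then have "\<psi> (d * \<phi> v) \<in> box (\<psi> l) (\<psi> u)"
        by (simp add: S_def box)
      moreover have "h (\<psi> (d * \<phi> v)) = v"
        by (simp add: h_def mult.assoc[symmetric] dd)
      ultimately show "v \<in> h ` box (\<psi> l) (\<psi> u)"
        by (metis imageI)
    next
      fix v assume "v \<in> h ` box (\<psi> l) (\<psi> u)"
      then obtain x where x: "x \<in> box (\<psi> l) (\<psi> u)" "v = h x"
        by blast
      have "d * \<phi> v = \<phi> x"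
        by (simp add: x(2) h_def mult.assoc[symmetric] dd)
      then show "v \<in> S"
        using x(1) box[of "\<phi> x"] by (simp add: S_def)
    qed
    have "linear h"
      unfolding h_def
      by (intro linear_compose[OF linear_compose[OF \<phi>_lin], unfolded comp_def, OF _ \<psi>_lin])
         (auto intro!: linearI simp: algebra_simps)
    moreover have "norm (h v) = norm v" for v
      using d by (simp add: h_def norm\<psi> norm_mult norm\<phi>)
    ultimately have h: "orthogonal_transformation h"
      by (simp add: orthogonal_transformation)
    have "S \<in> sets lborel"
      using measurable_sets[OF meas, of "box l u"] by (simp add: S_def)
    then have "emeasure lborel S = emeasure lebesgue S"
      by simp
    also have "\<dots> = ennreal (measure lebesgue S)"
      using measurable_orthogonal_image[OF h lmeasurable_box] by (simp add: S emeasure_eq_measure2)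
    also have "measure lebesgue S = measure lebesgue (box (\<psi> l) (\<psi> u))"
      unfolding S by (rule measure_orthogonal_image[OF h lmeasurable_box])
    also have "\<dots> = measure lborel (cbox (\<psi> l) (\<psi> u))"
      by (simp add: measure_lborel_box_eq measure_lborel_cbox_eq)
    also have "\<psi> l \<in> cbox (\<psi> l) (\<psi> u)"
      using le by (simp add: mem_box_cart forall_2 \<psi>_def)
    then have "measure lborel (cbox (\<psi> l) (\<psi> u)) = (Re u - Re l) * (Im u - Im l)"
      by (subst content_cbox_cart) (auto simp: UNIV_2 \<psi>_def)
    finally show "emeasure (distr lborel borel (\<lambda>v. d * \<phi> v)) (box l u) = (\<Prod>b\<in>Basis. (u - l) \<bullet> b)"
      using meas by (simp add: emeasure_distr S_def Basis_complex_def)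
  qed simp
  have m: "\<phi> \<in> borel_measurable lborel"
    using linear_continuous_on[OF linear_conv_bounded_linear[THEN iffD1, OF \<phi>_lin]]
    by (simp add: borel_measurable_continuous_onI)
  have "distr lborel borel ((*) c) = distr (distr lborel borel \<phi>) borel ((*) c)"
    using key[of 1] by simp
  also have "\<dots> = distr lborel borel (\<lambda>v. c * \<phi> v)"
    using m by (subst distr_distr) (auto simp: comp_def)
  also have "\<dots> = lborel"
    by (rule key) fact
  finally show ?thesis .
qed

lemma emeasure_complex_ball:
  fixes v :: complex
  assumes "s \<ge> 0"
  shows "emeasure lborel (ball v s) = ennreal (pi * s\<^sup>2)"
  using assms by (simp add: emeasure_ball unit_ball_vol_2 )

text \<open>
  The value at the centre is at most the mean of the modulus over the circle through \<open>v + z\<close>, for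
  each \<open>z\<close> of norm less than \<open>s\<close>. Integration over all these \<open>z\<close> and Tonelli lead to an average
  over rotation angles of integrals over the disk, which are all equal by rotation invariance. So
  polar coordinates are avoided.
\<close>

lemma area_submean_value:
  assumes hol: "g holomorphic_on ball v s" and s: "s \<ge> 0"
  shows "ennreal (norm (g v)) * ennreal (pi * s\<^sup>2)
    \<le> (\<integral>\<^sup>+w. ennreal (norm (g w)) * indicator (ball v s) w \<partial>lborel)"
proof -
  define e :: "real \<Rightarrow> complex" where "e t = exp (2 * of_real pi * \<i> * of_real t)" for t
  have ne [simp]: "norm (e t) = 1" for t
    by (simp add: e_def)
  have e_meas [measurable]: "e \<in> borel_measurable borel"
    unfolding e_def by (intro borel_measurable_continuous_onI continuous_intros)
  define G where "G w = ennreal (norm (g w)) * indicator (ball v s) w" for w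
  have G_meas [measurable]: "G \<in> borel_measurable borel"
  proof -
    have "(\<lambda>w. indicator (ball v s) w *\<^sub>R g w) \<in> borel_measurable borel"
      by (rule borel_measurable_continuous_on_indicator)
        (use hol holomorphic_on_imp_continuous_on in auto)
    then have "(\<lambda>w. ennreal (norm (indicator (ball v s) w *\<^sub>R g w))) \<in> borel_measurable borel"
      by measurable
    also have "(\<lambda>w. ennreal (norm (indicator (ball v s) w *\<^sub>R g w))) = G"
      by (auto simp: G_def indicator_def)
    finally show ?thesis .
  qed
  have circle: "ennreal (norm (g v)) * indicator (ball 0 s) z
      \<le> (\<integral>\<^sup>+t. G (v + e t * z) * indicator {0..1} t \<partial>lborel)" for z
  proof (cases "z \<in> ball 0 s")
    case True
    have sub: "(\<lambda>u. v + u * z) ` cball 0 1 \<subseteq> ball v s"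
    proof clarify
      fix u :: complex assume "u \<in> cball 0 1"
      then have "norm (u * z) \<le> 1 * norm z"
        unfolding norm_mult by (intro mult_right_mono) auto
      then show "v + u * z \<in> ball v s"
        using True by (simp add: dist_norm)
    qed
    \<comment> \<open>The circle through \<open>v + z\<close> is the image of the unit circle under \<open>u \<mapsto> v + u * z\<close>, also for \<open>z = 0\<close>.\<close>
    have holG: "(\<lambda>u. g (v + u * z)) holomorphic_on cball 0 1"
      using holomorphic_on_compose_gen[OF _ hol sub] by (simp add: comp_def holomorphic_intros)
    define k where "k t = g (v + e t * z)" for t
    have I: "(k has_integral g v) {0..1}"
      using circle_mean_value[of "\<lambda>u. g (v + u * z)"] holG
      by (simp add: holomorphic_on_imp_continuous_on holomorphic_on_subset[OF holG] e_def k_def[abs_def])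
    have k_cont: "continuous_on {0..1} k"
    proof -
      have "continuous_on {0..1} ((\<lambda>u. g (v + u * z)) \<circ> e)"
        unfolding e_def
        by (intro continuous_on_compose continuous_intros
              continuous_on_subset[OF holomorphic_on_imp_continuous_on[OF holG]]) auto
      then show ?thesis
        by (simp add: k_def comp_def)
    qed
    have nk: "(\<lambda>t. norm (k t)) integrable_on {0..1}"
      by (intro integrable_continuous_real continuous_intros k_cont)
    have "norm (g v) \<le> integral {0..1} (\<lambda>t. norm (k t))"
      using integral_norm_bound_integral[of k "{0..1}" "\<lambda>t. norm (k t)"] I nk
      by (auto simp: has_integral_iff)
    then have "ennreal (norm (g v)) \<le> ennreal (integral {0..1} (\<lambda>t. norm (k t)))"
      by (rule ennreal_leI)
    also have "\<dots> = (\<integral>\<^sup>+t. ennreal (norm (k t)) * indicator {0..1} t \<partial>lborel)"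
      by (rule nn_integral_has_integral_lebesgue'[symmetric]) (use nk in auto)
    also have "\<dots> = (\<integral>\<^sup>+t. G (v + e t * z) * indicator {0..1} t \<partial>lborel)"
      using True by (intro nn_integral_cong) (simp add: G_def k_def dist_norm norm_mult)
    finally show ?thesis
      using True by simp
  qed simp
  have rot: "(\<integral>\<^sup>+z. G (v + e t * z) \<partial>lborel) = (\<integral>\<^sup>+w. G w \<partial>lborel)" for t
  proof -
    have "(\<integral>\<^sup>+w. G w \<partial>lborel) = (\<integral>\<^sup>+w. G w \<partial>distr lborel borel ((+) v))"
      by (simp add: lborel_distr_plus)
    also have "\<dots> = (\<integral>\<^sup>+w. G (v + w) \<partial>distr lborel borel ((*) (e t)))"
      by (simp add: nn_integral_distr lborel_complex_distr_rotation)
    also have "\<dots> = (\<integral>\<^sup>+z. G (v + e t * z) \<partial>lborel)"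
      by (simp add: nn_integral_distr)
    finally show ?thesis ..
  qed
  have "ennreal (norm (g v)) * ennreal (pi * s\<^sup>2)
      = (\<integral>\<^sup>+z. ennreal (norm (g v)) * indicator (ball 0 s) (z::complex) \<partial>lborel)"
    using emeasure_complex_ball[OF s, of 0] by (subst nn_integral_cmult_indicator) auto
  also have "\<dots> \<le> (\<integral>\<^sup>+z. \<integral>\<^sup>+t. G (v + e t * z) * indicator {0..1} t \<partial>lborel \<partial>lborel)"
    by (intro nn_integral_mono circle)
  also have "\<dots> = (\<integral>\<^sup>+t. \<integral>\<^sup>+z. G (v + e t * z) * indicator {0..1} t \<partial>lborel \<partial>lborel)"
    by (rule lborel_pair.Fubini') measurable
  also have "\<dots> = (\<integral>\<^sup>+t. (\<integral>\<^sup>+w. G w \<partial>lborel) * indicator {0..1::real} t \<partial>lborel)"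
    by (intro nn_integral_cong) (simp add: nn_integral_multc rot)
  also have "\<dots> = (\<integral>\<^sup>+w. G w \<partial>lborel)"
    by (subst nn_integral_cmult_indicator) auto
  finally show ?thesis
    by (simp add: G_def)
qed

section \<open>Averages over Whitney disks\<close>

text \<open>
  The kernel restricts \<open>u\<close> to the disk about \<open>w\<close> whose radius is the fraction \<open>r\<close> of the distance
  from \<open>w\<close> to the unit circle. The weight is the density of the hyperbolic area up to a bounded
  factor, so it makes all these disks comparable in size. For \<open>r \<ge> 0\<close> it vanishes unless \<open>w\<close> lies
  in the unit disk.
\<close>

definition whitney_kernel :: "real \<Rightarrow> complex \<Rightarrow> complex \<Rightarrow> ennreal" where
  "whitney_kernel r w u =
     (if dist w u < r * (1 - norm w) then ennreal (1 / (1 - norm w)\<^sup>2) else 0)"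

lemma borel_measurable_whitney_kernel:
  assumes [measurable]: "a \<in> borel_measurable M" "b \<in> borel_measurable M"
  shows "(\<lambda>x. whitney_kernel r (a x) (b x)) \<in> borel_measurable M"
  unfolding whitney_kernel_def by measurable

lemma whitney_kernel_outside: "norm w \<ge> 1 \<Longrightarrow> r \<ge> 0 \<Longrightarrow> whitney_kernel r w u = 0"
proof -
  assume "norm w \<ge> 1" "r \<ge> 0"
  then have "r * (1 - norm w) \<le> 0"
    by (simp add: mult_nonneg_nonpos)
  then have "\<not> dist w u < r * (1 - norm w)"
    by (smt (verit) zero_le_dist)
  then show ?thesis
    by (simp add: whitney_kernel_def)
qed

text \<open>
  If \<open>w\<close> is within \<open>r / 2\<close> times the boundary distance \<open>m\<close> of \<open>u\<close>, then the boundary distance of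
  \<open>w\<close> is between \<open>m / 2\<close> and \<open>2 * m\<close>. So the kernel is at least \<open>1 / (4 * m\<^sup>2)\<close> on a disk of
  radius \<open>r * m / 2\<close>.
\<close>

lemma nn_integral_whitney_kernel_ge:
  assumes r: "0 < r" "r \<le> 1" and u: "norm u < 1"
  shows "ennreal (pi * r\<^sup>2 / 16) \<le> (\<integral>\<^sup>+w. whitney_kernel r w u \<partial>lborel)"
proof -
  define m where "m = 1 - norm u"
  have m: "m > 0"
    using u by (simp add: m_def)
  have "ennreal (pi * r\<^sup>2 / 16) = ennreal (1 / (4 * m\<^sup>2)) * ennreal (pi * (r / 2 * m)\<^sup>2)"
    using m by (subst ennreal_mult[symmetric]) (auto simp: field_simps power2_eq_square)
  also have "\<dots> = (\<integral>\<^sup>+w. ennreal (1 / (4 * m\<^sup>2)) * indicator (ball u (r / 2 * m)) w \<partial>lborel)"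
    using r m by (subst nn_integral_cmult_indicator) (auto simp: emeasure_complex_ball)
  also have "\<dots> \<le> (\<integral>\<^sup>+w. whitney_kernel r w u \<partial>lborel)"
  proof (rule nn_integral_mono)
    fix w
    show "ennreal (1 / (4 * m\<^sup>2)) * indicator (ball u (r / 2 * m)) w \<le> whitney_kernel r w u"
    proof (cases "w \<in> ball u (r / 2 * m)")
      case True
      have le: "norm w \<le> norm u + dist w u" "norm u \<le> norm w + dist w u"
        using norm_triangle_ineq2[of w u] norm_triangle_ineq2[of u w]
        by (simp_all add: dist_norm norm_minus_commute)
      have d: "dist w u < r / 2 * m"
        using True by (simp add: dist_commute)
      have "r / 2 * m \<le> 1 / 2 * m"
        using r m by (intro mult_right_mono) auto
      then have half: "m / 2 < 1 - norm w" "1 - norm w \<le> 2 * m"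
        using le d m by (auto simp: m_def)
      have "r / 2 * m = r * (m / 2)"
        by simp
      also have "\<dots> \<le> r * (1 - norm w)"
        using half r by (intro mult_left_mono) auto
      finally have "dist w u < r * (1 - norm w)"
        using d by simp
      moreover have "1 / (4 * m\<^sup>2) \<le> 1 / (1 - norm w)\<^sup>2"
      proof (rule divide_left_mono)
        have "(1 - norm w)\<^sup>2 \<le> (2 * m)\<^sup>2"
          using half m by (intro power_mono) auto
        then show "(1 - norm w)\<^sup>2 \<le> 4 * m\<^sup>2"
          by (simp add: power_mult_distrib)
      qed (use half m in auto)
      ultimately show ?thesis
        using True by (auto simp: whitney_kernel_def intro!: ennreal_leI)
    qed simp
  qed
  finally show ?thesis .
qed

text \<open>
  This continuous form of the finite overlap of Whitney disks holds because every \<open>w\<close> with a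
  nonzero kernel has boundary distance between \<open>m / 2\<close> and \<open>m / (1 - r)\<close>, where \<open>m\<close> is the
  boundary distance of \<open>u\<close>.
\<close>

lemma nn_integral_whitney_kernel_le:
  assumes r: "0 < r" "r < 1"
  shows "(\<integral>\<^sup>+w. whitney_kernel r w u \<partial>lborel) \<le> ennreal (4 * pi / (1 - r)\<^sup>2)"
proof -
  define m where "m = 1 - norm u"
  \<comment> \<open>Positivity of \<open>m\<close> is included so that the kernel is seen to vanish when \<open>u\<close> is outside the disk.\<close>
  have bound: "0 < m \<and> whitney_kernel r w u
      \<le> ennreal (4 / m\<^sup>2) * indicator (ball u (m / (1 - r))) w"
    if k: "whitney_kernel r w u \<noteq> 0" for w
  proof -
    have d: "dist w u < r * (1 - norm w)"
      using k by (auto simp: whitney_kernel_def split: if_splits)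
    have le: "norm w \<le> norm u + dist w u" "norm u \<le> norm w + dist w u"
      using norm_triangle_ineq2[of w u] norm_triangle_ineq2[of u w]
      by (simp_all add: dist_norm norm_minus_commute)
    have w: "0 < 1 - norm w"
      using k whitney_kernel_outside[of w r u] r by (cases "norm w < 1") auto
    have "r * (1 - norm w) \<le> 1 * (1 - norm w)"
      using r w by (intro mult_right_mono) auto
    then have m2: "m \<le> 2 * (1 - norm w)"
      using le d by (simp add: m_def)
    have m1: "(1 - r) * (1 - norm w) < m"
      using le d by (simp add: m_def algebra_simps)
    have "0 < (1 - r) * (1 - norm w)"
      using w r by simp
    then have m: "0 < m"
      using m1 by simp
    have mr: "1 - norm w < m / (1 - r)"
      using m1 r by (simp add: field_simps)
    have "r * (1 - norm w) < m / (1 - r)"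
      using mr \<open>r * (1 - norm w) \<le> 1 * (1 - norm w)\<close> by simp
    then have "w \<in> ball u (m / (1 - r))"
      using d by (simp add: dist_commute)
    moreover have "1 / (1 - norm w)\<^sup>2 \<le> 4 / m\<^sup>2"
    proof -
      have "m\<^sup>2 \<le> (2 * (1 - norm w))\<^sup>2"
        using m2 m by (intro power_mono) auto
      then have "4 / (2 * (1 - norm w))\<^sup>2 \<le> 4 / m\<^sup>2"
        using w m by (intro divide_left_mono) auto
      then show ?thesis
        unfolding power_mult_distrib by simp
    qed
    ultimately show ?thesis
      using d m by (auto simp: whitney_kernel_def intro!: ennreal_leI)
  qed
  show ?thesis
  proof (cases "0 < m")
    case True
    have "(\<integral>\<^sup>+w. whitney_kernel r w u \<partial>lborel)
        \<le> (\<integral>\<^sup>+w. ennreal (4 / m\<^sup>2) * indicator (ball u (m / (1 - r))) w \<partial>lborel)"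
      using bound by (intro nn_integral_mono) (metis zero_le)
    also have "\<dots> = ennreal (4 / m\<^sup>2) * ennreal (pi * (m / (1 - r))\<^sup>2)"
      using r True by (subst nn_integral_cmult_indicator) (auto simp: emeasure_complex_ball)
    also have "\<dots> = ennreal (4 * pi / (1 - r)\<^sup>2)"
      using r True by (subst ennreal_mult[symmetric]) (auto simp: field_simps)
    finally show ?thesis .
  next
    case False
    then have "whitney_kernel r w u = 0" for w
      using bound by blast
    then show ?thesis
      by simp
  qed
qed

lemma ball_subset_unit_disk:
  assumes "norm w < 1" "r \<le> 1"
  shows "ball w (r * (1 - norm w)) \<subseteq> unit_disk"
proof
  fix y assume "y \<in> ball w (r * (1 - norm w))"
  then have "dist w y < r * (1 - norm w)"
    by simp
  moreover have "r * (1 - norm w) \<le> 1 * (1 - norm w)"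
    using assms by (intro mult_right_mono) auto
  moreover have "norm y \<le> norm w + dist w y"
    using norm_triangle_ineq2[of y w] by (simp add: dist_norm norm_minus_commute)
  ultimately show "y \<in> unit_disk"
    by simp
qed

text \<open>
  Up to constants this is the mean of \<open>|f|\<^sup>2\<close> over the disk about \<open>w\<close>. The indicator cuts off the
  arbitrary values of \<open>f\<close> outside the unit disk.
\<close>

definition local_energy :: "real \<Rightarrow> (complex \<Rightarrow> complex) \<Rightarrow> complex \<Rightarrow> ennreal" where
  "local_energy r f w = (\<integral>\<^sup>+v. ennreal ((norm (f v))\<^sup>2) * indicator unit_disk v *
     whitney_kernel r w v \<partial>lborel)"

lemma borel_measurable_holomorphic_density:
  assumes "f holomorphic_on unit_disk"
  shows "(\<lambda>v. ennreal ((norm (f v))\<^sup>2) * indicator unit_disk v) \<in> borel_measurable borel"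
proof -
  have "(\<lambda>v. indicator unit_disk v *\<^sub>R f v) \<in> borel_measurable borel"
    by (rule borel_measurable_continuous_on_indicator)
      (use assms holomorphic_on_imp_continuous_on in auto)
  then have "(\<lambda>v. ennreal ((norm (indicator unit_disk v *\<^sub>R f v))\<^sup>2)) \<in> borel_measurable borel"
    by measurable
  also have "(\<lambda>v. ennreal ((norm (indicator unit_disk v *\<^sub>R f v))\<^sup>2))
      = (\<lambda>v. ennreal ((norm (f v))\<^sup>2) * indicator unit_disk v)"
    by (auto simp: indicator_def)
  finally show ?thesis .
qed

lemma borel_measurable_local_energy:
  assumes "f holomorphic_on unit_disk"
  shows "local_energy r f \<in> borel_measurable borel"
proof -
  note [measurable] = borel_measurable_holomorphic_density[OF assms]
    borel_measurable_whitney_kernel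
  show ?thesis
    unfolding local_energy_def[abs_def]
    by (rule lborel.borel_measurable_nn_integral) measurable
qed

lemma bergman_norm_nonneg: "bergman_norm f \<ge> 0"
  by (auto simp: bergman_norm_def set_lebesgue_integral_def
      intro!: mult_nonneg_nonneg integral_nonneg_AE)

lemma nn_integral_bergman:
  assumes "f \<in> bergman_space"
  shows "(\<integral>\<^sup>+v. ennreal ((norm (f v))\<^sup>2) * indicator unit_disk v \<partial>lborel)
    = ennreal (pi * (bergman_norm f)\<^sup>2)"
proof -
  let ?h = "\<lambda>v. indicator unit_disk v *\<^sub>R (norm (f v))\<^sup>2"
  have int: "integrable lborel ?h"
    using assms by (simp add: bergman_space_def set_integrable_def)
  have "(LINT v:unit_disk|lborel. (norm (f v))\<^sup>2) = integral\<^sup>L lborel ?h"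
    by (simp add: set_lebesgue_integral_def)
  moreover have "integral\<^sup>L lborel ?h \<ge> 0"
    by (intro integral_nonneg_AE) auto
  ultimately have "pi * (bergman_norm f)\<^sup>2 = integral\<^sup>L lborel ?h"
    by (simp add: bergman_norm_def)
  moreover have "(\<integral>\<^sup>+v. ennreal ((norm (f v))\<^sup>2) * indicator unit_disk v \<partial>lborel)
      = (\<integral>\<^sup>+v. ennreal (?h v) \<partial>lborel)"
    by (intro nn_integral_cong) (auto simp: indicator_def)
  ultimately show ?thesis
    using nn_integral_eq_integral[OF int] by simp
qed

text \<open>
  Tonelli moves the integration over \<open>w\<close> to the kernel, which has bounded integral.
\<close>

lemma nn_integral_local_energy_le:
  assumes f: "f \<in> bergman_space" and r: "0 < r" "r < 1"
  shows "(\<integral>\<^sup>+w. local_energy r f w \<partial>lborel)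
    \<le> ennreal (4 * pi\<^sup>2 / (1 - r)\<^sup>2 * (bergman_norm f)\<^sup>2)"
proof -
  have hol: "f holomorphic_on unit_disk"
    using f by (simp add: bergman_space_def)
  note [measurable] = borel_measurable_holomorphic_density[OF hol]
    borel_measurable_whitney_kernel
  let ?F = "\<lambda>v. ennreal ((norm (f v))\<^sup>2) * indicator unit_disk v"
  have "(\<integral>\<^sup>+w. local_energy r f w \<partial>lborel)
      = (\<integral>\<^sup>+v. \<integral>\<^sup>+w. ?F v * whitney_kernel r w v \<partial>lborel \<partial>lborel)"
    unfolding local_energy_def by (rule lborel_pair.Fubini') measurable
  also have "\<dots> = (\<integral>\<^sup>+v. ?F v * (\<integral>\<^sup>+w. whitney_kernel r w v \<partial>lborel) \<partial>lborel)"
    by (intro nn_integral_cong nn_integral_cmult) measurable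
  also have "\<dots> \<le> (\<integral>\<^sup>+v. ?F v * ennreal (4 * pi / (1 - r)\<^sup>2) \<partial>lborel)"
    by (intro nn_integral_mono mult_left_mono nn_integral_whitney_kernel_le r) auto
  also have "\<dots> = ennreal (pi * (bergman_norm f)\<^sup>2) * ennreal (4 * pi / (1 - r)\<^sup>2)"
    by (subst nn_integral_multc) (auto simp: nn_integral_bergman[OF f])
  also have "\<dots> = ennreal (4 * pi\<^sup>2 / (1 - r)\<^sup>2 * (bergman_norm f)\<^sup>2)"
    by (subst ennreal_mult[symmetric]) (auto simp: power2_eq_square mult_ac)
  finally show ?thesis .
qed

lemma local_energy_finite:
  assumes f: "f \<in> bergman_space"
  shows "local_energy r f w < \<infinity>"
proof -
  have hol: "f holomorphic_on unit_disk"
    using f by (simp add: bergman_space_def)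
  have "local_energy r f w \<le> (\<integral>\<^sup>+v. ennreal ((norm (f v))\<^sup>2) * indicator unit_disk v *
      ennreal (1 / (1 - norm w)\<^sup>2) \<partial>lborel)"
    unfolding local_energy_def
    by (intro nn_integral_mono mult_left_mono) (auto simp: whitney_kernel_def)
  also have "\<dots> = ennreal (pi * (bergman_norm f)\<^sup>2) * ennreal (1 / (1 - norm w)\<^sup>2)"
    using borel_measurable_holomorphic_density[OF hol]
    by (subst nn_integral_multc) (auto simp: nn_integral_bergman[OF f])
  also have "\<dots> < \<infinity>"
    by (simp add: ennreal_mult_less_top)
  finally show ?thesis .
qed

text \<open>
  Two separate radii keep the constant free of \<open>l\<close> apart from the factor \<open>l! / p\<^sup>l\<close>. The Cauchy
  inequality on the circle of radius \<open>p * (1 - norm w)\<close> about \<open>u\<close> produces that factor with nothing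
  lost, and the mean value inequality for \<open>f\<^sup>2\<close> on disks of the fixed relative radius \<open>d\<close> bounds
  \<open>f\<close> on this circle. The condition \<open>p + 2 * d \<le> r\<close> keeps all these disks inside the disk of
  relative radius \<open>r\<close> about \<open>w\<close>. The estimate is uniform for \<open>u\<close> near \<open>w\<close> and uses the boundary
  distance of \<open>w\<close>, not of \<open>u\<close>: replacing one by the other would cost a factor exponential in \<open>l\<close>.
\<close>

lemma norm_higher_deriv_le_local_energy:
  assumes f: "f \<in> bergman_space"
    and pd: "0 < p" "0 < d" "p + 2 * d \<le> r" "r < 1"
    and w: "norm w < 1" and u: "dist w u < d * (1 - norm w)"
  shows "norm ((deriv ^^ l) f u)
    \<le> fact l / (p * (1 - norm w)) ^ l * sqrt (enn2real (local_energy r f w) / (pi * d\<^sup>2))"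
proof -
  have hol: "f holomorphic_on unit_disk"
    using f by (simp add: bergman_space_def)
  note [measurable] = borel_measurable_holomorphic_density[OF hol]
    borel_measurable_whitney_kernel
  define m where "m = 1 - norm w"
  have m: "m > 0"
    using w by (simp add: m_def)
  define B where "B = sqrt (enn2real (local_energy r f w) / (pi * d\<^sup>2))"
  have disk: "ball w (r * m) \<subseteq> unit_disk"
    using ball_subset_unit_disk[OF w] pd by (simp add: m_def)
  have near: "x \<in> ball w (r * m) \<and> ball x (d * m) \<subseteq> ball w (r * m)" if x: "dist u x \<le> p * m" for x
  proof -
    have rm: "(p + 2 * d) * m \<le> r * m"
      using pd m by (intro mult_right_mono) auto
    have "dist w y < r * m" if "dist x y < d * m" for y
      using dist_triangle[of w y u] dist_triangle[of u y x] x u rm that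
      by (simp add: algebra_simps m_def)
    moreover have "dist x x < d * m"
      using pd m by simp
    ultimately show ?thesis
      by auto
  qed
  have point: "norm (f x) \<le> B" if x: "dist u x \<le> p * m" for x
  proof -
    have "f holomorphic_on ball x (d * m)"
      using near[OF x] disk holomorphic_on_subset[OF hol] by blast
    then have "(\<lambda>v. (f v)\<^sup>2) holomorphic_on ball x (d * m)"
      by (intro holomorphic_intros)
    from area_submean_value[OF this]
    have "ennreal (norm ((f x)\<^sup>2)) * ennreal (pi * (d * m)\<^sup>2)
        \<le> (\<integral>\<^sup>+v. ennreal (norm ((f v)\<^sup>2)) * indicator (ball x (d * m)) v \<partial>lborel)"
      using pd m by simp
    also have "\<dots> \<le> (\<integral>\<^sup>+v. ennreal (m\<^sup>2) * (ennreal ((norm (f v))\<^sup>2) * indicator unit_disk v *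
        whitney_kernel r w v) \<partial>lborel)"
    proof (rule nn_integral_mono)
      fix v
      show "ennreal (norm ((f v)\<^sup>2)) * indicator (ball x (d * m)) v
          \<le> ennreal (m\<^sup>2) * (ennreal ((norm (f v))\<^sup>2) * indicator unit_disk v * whitney_kernel r w v)"
      proof (cases "v \<in> ball x (d * m)")
        case True
        then have v: "v \<in> ball w (r * m)" "v \<in> unit_disk"
          using near[OF x] disk by blast+
        have "ennreal (m\<^sup>2) * ennreal (1 / m\<^sup>2) = 1"
          using m by (subst ennreal_mult[symmetric]) auto
        then have "ennreal (m\<^sup>2) * whitney_kernel r w v = 1"
          using v by (simp add: whitney_kernel_def m_def)
        then have "ennreal (m\<^sup>2) * (a * whitney_kernel r w v) = a" for a
          by (simp add: mult.left_commute)
        then show ?thesis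
          using True v by (simp add: norm_power)
      qed simp
    qed
    also have "\<dots> = ennreal (m\<^sup>2) * local_energy r f w"
      unfolding local_energy_def by (rule nn_integral_cmult) measurable
    also have "local_energy r f w = ennreal (enn2real (local_energy r f w))"
      using local_energy_finite[OF f, of r w] by simp
    finally have "(norm (f x))\<^sup>2 * (pi * (d * m)\<^sup>2) \<le> m\<^sup>2 * enn2real (local_energy r f w)"
      by (simp add: ennreal_mult[symmetric] norm_power)
    then have "(norm (f x))\<^sup>2 * (pi * d\<^sup>2) \<le> enn2real (local_energy r f w)"
      using m by (simp add: power_mult_distrib mult.left_commute[of _ "m\<^sup>2"])
    then have "(norm (f x))\<^sup>2 \<le> enn2real (local_energy r f w) / (pi * d\<^sup>2)"
      using pd by (simp add: pos_le_divide_eq)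
    then show ?thesis
      unfolding B_def by (rule real_le_rsqrt)
  qed
  have "cball u (p * m) \<subseteq> unit_disk"
    using near disk by (metis mem_cball subset_iff)
  then have "f holomorphic_on cball u (p * m)"
    by (rule holomorphic_on_subset[OF hol])
  then have "norm ((deriv ^^ l) f u) \<le> fact l * B / (p * m) ^ l"
    using pd m point
    by (intro Cauchy_inequality) (auto simp: dist_norm holomorphic_on_imp_continuous_on
        elim: holomorphic_on_subset)
  then show ?thesis
    by (simp add: B_def m_def)
qed

section \<open>A Carleson embedding for derivatives\<close>

lemma space_borel_disk: "sets N = borel_disk \<Longrightarrow> space N = unit_disk"
  by (metis sets_eq_imp_space_eq space_restrict_space space_borel Int_UNIV_right)

lemma form_integrand_measurable:
  assumes "f holomorphic_on unit_disk" "g holomorphic_on unit_disk" "sets N = borel_disk"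
  shows "form_integrand l j f g \<in> borel_measurable N"
proof -
  have "continuous_on unit_disk (form_integrand l j f g)"
    unfolding form_integrand_def[abs_def] using assms
    by (intro continuous_intros holomorphic_on_imp_continuous_on holomorphic_higher_deriv) auto
  then show ?thesis
    using measurable_cong_sets[OF assms(3) refl] borel_measurable_continuous_on_restrict
    by blast
qed

lemma ennreal_le_of_power2_le:
  assumes "x\<^sup>2 \<le> ennreal (y\<^sup>2)" "0 \<le> y"
  shows "x \<le> ennreal y"
proof (cases x)
  case (real t)
  then have "t\<^sup>2 \<le> y\<^sup>2"
    using assms by (simp add: ennreal_power)
  then show ?thesis
    using real assms(2) by (auto intro!: ennreal_leI elim: power2_le_imp_le)
next
  case top
  then show ?thesis
    using assms by (simp add: power2_eq_square ennreal_top_mult top_unique)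
qed

text \<open>
  The positive measure \<open>N\<close> is averaged against the Whitney kernel of the small relative radius \<open>d\<close>,
  which turns the integral over \<open>N\<close> into an area integral of local contributions. In the
  contribution of \<open>w\<close> both derivatives are bounded by local energies at \<open>w\<close>, and the powers
  of \<open>p * (1 - norm w)\<close> that appear are exactly compensated by the assumed bound on the mass of the
  disk about \<open>w\<close>. What is left is the product of the square roots of the two local energies, to
  which the Cauchy-Schwarz inequality applies.
\<close>

lemma carleson_derivative_embedding:
  assumes p: "0 < p" "p < 1" and f: "f \<in> bergman_space" and g: "g \<in> bergman_space"
    and sets: "sets N = borel_disk" and sf: "sigma_finite_measure N" and B: "0 \<le> B"
    and carleson: "\<And>w. norm w < 1 \<Longrightarrow> emeasure N (ball w (1 / 2 * (1 - norm w)))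
      \<le> ennreal (B * (1 - norm w) ^ (l + j + 2) * p ^ (l + j))"
  shows "(\<integral>\<^sup>+u. ennreal (norm (form_integrand l j f g u)) \<partial>N)
    \<le> ennreal (4 ^ 8 / (1 - p) ^ 6 * fact l * fact j * B * bergman_norm f * bergman_norm g)"
proof -
  interpret N: sigma_finite_measure N by fact
  interpret pair_sigma_finite N lborel ..
  have holf: "f holomorphic_on unit_disk" and holg: "g holomorphic_on unit_disk"
    using f g by (simp_all add: bergman_space_def)
  have space: "space N = unit_disk"
    by (rule space_borel_disk[OF sets])
  \<comment> \<open>The gap between \<open>p\<close> and 1 is cut into four: one \<open>d\<close> for moving \<open>u\<close>, one for the mean value disks, and two left between \<open>r\<close> and 1.\<close>
  define d r where "d = (1 - p) / 4" and "r = (1 + p) / 2"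
  have dr: "0 < d" "d < 1 / 2" "d \<le> 1" "p + 2 * d \<le> r" "0 < r" "r < 1" "1 - r = 2 * d"
    using p by (auto simp: d_def r_def field_simps)
  define h where "h u = ennreal (norm (form_integrand l j f g u))" for u
  have id_meas: "(\<lambda>u. u) \<in> borel_measurable N"
    using measurable_cong_sets[OF sets refl] borel_measurable_continuous_on_restrict[of _ "\<lambda>u. u"]
    by auto
  have h_meas [measurable]: "h \<in> borel_measurable N"
    unfolding h_def using form_integrand_measurable[OF holf holg sets] by measurable
  have fst_meas: "fst \<in> borel_measurable (N \<Otimes>\<^sub>M (lborel :: complex measure))"
    by (rule measurable_compose[OF measurable_fst id_meas])
  have ker [measurable]: "(\<lambda>x. whitney_kernel d (snd x) (fst x)) \<in> borel_measurable (N \<Otimes>\<^sub>M lborel)"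
    by (intro borel_measurable_whitney_kernel fst_meas) measurable
  have ker1: "(\<lambda>u. whitney_kernel d w u) \<in> borel_measurable N" for w
    by (intro borel_measurable_whitney_kernel id_meas) simp
  have [measurable]: "local_energy r f \<in> borel_measurable borel"
      "local_energy r g \<in> borel_measurable borel"
    using borel_measurable_local_energy holf holg by auto
  define a b where "a w = sqrt (enn2real (local_energy r f w))"
    and "b w = sqrt (enn2real (local_energy r g w))" for w
  have ab0: "a w \<ge> 0" "b w \<ge> 0" for w
    by (simp_all add: a_def b_def)
  define c where "c = fact l * fact j * B / (pi * d\<^sup>2)"
  have c: "c \<ge> 0"
    using B by (simp add: c_def)
  have inner: "(\<integral>\<^sup>+u. h u * whitney_kernel d w u \<partial>N)
      \<le> ennreal c * (ennreal (a w) * ennreal (b w))" for w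
  proof (cases "norm w < 1")
    case True
    define m where "m = 1 - norm w"
    have m: "m > 0"
      using True by (simp add: m_def)
    define x y s where "x = (p * m) ^ l" and "y = (p * m) ^ j" and "s = sqrt pi * d"
    have xys: "x > 0" "y > 0" "s > 0" "s\<^sup>2 = pi * d\<^sup>2"
      using p m dr by (simp_all add: x_def y_def s_def power_mult_distrib)
    define D\<^sub>f D\<^sub>g where "D\<^sub>f = fact l / x * (a w / s)" and "D\<^sub>g = fact j / y * (b w / s)"
    have D: "D\<^sub>f \<ge> 0" "D\<^sub>g \<ge> 0"
      using xys ab0[of w] by (simp_all add: D\<^sub>f_def D\<^sub>g_def)
    define D where "D = D\<^sub>f * D\<^sub>g"
    have D0: "D \<ge> 0"
      using D by (simp add: D_def)
    \<comment> \<open>The same bound serves for all points \<open>u\<close> that the kernel sees from \<open>w\<close>.\<close>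
    have h_le: "h u \<le> ennreal D" if "dist w u < d * (1 - norm w)" for u
    proof -
      have "norm ((deriv ^^ l) f u) \<le> D\<^sub>f"
        using norm_higher_deriv_le_local_energy[OF f p(1) dr(1,4,6) True that, of l]
        unfolding m_def[symmetric] xys(4)[symmetric]
        using xys(3) by (simp add: a_def real_sqrt_divide D\<^sub>f_def x_def)
      moreover have "norm ((deriv ^^ j) g u) \<le> D\<^sub>g"
        using norm_higher_deriv_le_local_energy[OF g p(1) dr(1,4,6) True that, of j]
        unfolding m_def[symmetric] xys(4)[symmetric]
        using xys(3) by (simp add: b_def real_sqrt_divide D\<^sub>g_def y_def)
      ultimately have "norm (form_integrand l j f g u) \<le> D"
        unfolding form_integrand_def D_def norm_mult complex_mod_cnj
        by (rule mult_mono) (use D in auto)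
      then show ?thesis
        unfolding h_def by (rule ennreal_leI)
    qed
    have "h u * whitney_kernel d w u
        \<le> ennreal D * ennreal (1 / m\<^sup>2) * indicator (ball w (1 / 2 * m)) u" for u
    proof (cases "dist w u < d * m")
      case True
      have "d * m \<le> 1 / 2 * m"
        using dr m by (intro mult_right_mono) auto
      then have "u \<in> ball w (1 / 2 * m)"
        using True by simp
      then show ?thesis
        using True h_le[of u]
        by (auto simp: whitney_kernel_def m_def intro!: mult_right_mono)
    qed (simp add: whitney_kernel_def m_def)
    then have "(\<integral>\<^sup>+u. h u * whitney_kernel d w u \<partial>N)
        \<le> (\<integral>\<^sup>+u. ennreal D * ennreal (1 / m\<^sup>2) * indicator (ball w (1 / 2 * m)) u \<partial>N)"
      by (intro nn_integral_mono)
    also have "\<dots> = ennreal D * ennreal (1 / m\<^sup>2) * emeasure N (ball w (1 / 2 * m))"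
    proof (rule nn_integral_cmult_indicator)
      have "ball w (1 / 2 * m) \<subseteq> unit_disk"
        using ball_subset_unit_disk[OF True, of "1 / 2"] by (simp add: m_def)
      then show "ball w (1 / 2 * m) \<in> sets N"
        unfolding sets by (subst sets_restrict_space_iff) auto
    qed
    also have "\<dots> \<le> ennreal D * ennreal (1 / m\<^sup>2) * ennreal (B * m ^ (l + j + 2) * p ^ (l + j))"
      using carleson[OF True] by (intro mult_left_mono) (auto simp: m_def)
    also have "\<dots> = ennreal (D * (1 / m\<^sup>2) * (B * m ^ (l + j + 2) * p ^ (l + j)))"
    proof -
      have "0 \<le> 1 / m\<^sup>2" "0 \<le> D * (1 / m\<^sup>2)" "0 \<le> B * m ^ (l + j + 2) * p ^ (l + j)"
        using D0 m B p by auto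
      then show ?thesis
        by (simp only: ennreal_mult D0)
    qed
    also have "D * (1 / m\<^sup>2) * (B * m ^ (l + j + 2) * p ^ (l + j)) = c * (a w * b w)"
    proof -
      \<comment> \<open>The mass of the disk cancels the two Cauchy factors \<open>x\<close> and \<open>y\<close>.\<close>
      have weight: "B * m ^ (l + j + 2) * p ^ (l + j) = B * (x * y * m\<^sup>2)"
        by (simp add: x_def y_def power_mult_distrib power_add power2_eq_square mult_ac)
      have D_eq: "D = fact l * fact j * (a w * b w) / (x * y * s\<^sup>2)"
        by (simp add: D_def D\<^sub>f_def D\<^sub>g_def power2_eq_square mult_ac)
      have c_eq: "c = fact l * fact j * B / s\<^sup>2"
        by (simp add: c_def xys(4))
      show ?thesis
        unfolding weight D_eq c_eq using xys(1-3) m by simp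
    qed
    finally show ?thesis
      using c ab0[of w] by (simp add: ennreal_mult)
  qed (use dr in \<open>simp add: whitney_kernel_outside\<close>)
  have sq: "(\<integral>\<^sup>+w. (ennreal (a w))\<^sup>2 \<partial>lborel) \<le> ennreal (pi\<^sup>2 / d\<^sup>2 * (bergman_norm f)\<^sup>2)"
      "(\<integral>\<^sup>+w. (ennreal (b w))\<^sup>2 \<partial>lborel) \<le> ennreal (pi\<^sup>2 / d\<^sup>2 * (bergman_norm g)\<^sup>2)"
  proof -
    have const: "4 * pi\<^sup>2 / (1 - r)\<^sup>2 = pi\<^sup>2 / d\<^sup>2"
      by (simp add: dr(7) power_mult_distrib)
    have "(\<integral>\<^sup>+w. (ennreal (a w))\<^sup>2 \<partial>lborel) = (\<integral>\<^sup>+w. local_energy r f w \<partial>lborel)"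
      using local_energy_finite[OF f]
      by (intro nn_integral_cong) (simp add: a_def ennreal_power)
    then show "(\<integral>\<^sup>+w. (ennreal (a w))\<^sup>2 \<partial>lborel) \<le> ennreal (pi\<^sup>2 / d\<^sup>2 * (bergman_norm f)\<^sup>2)"
      using nn_integral_local_energy_le[OF f dr(5,6)] by (simp only: const)
    have "(\<integral>\<^sup>+w. (ennreal (b w))\<^sup>2 \<partial>lborel) = (\<integral>\<^sup>+w. local_energy r g w \<partial>lborel)"
      using local_energy_finite[OF g]
      by (intro nn_integral_cong) (simp add: b_def ennreal_power)
    then show "(\<integral>\<^sup>+w. (ennreal (b w))\<^sup>2 \<partial>lborel) \<le> ennreal (pi\<^sup>2 / d\<^sup>2 * (bergman_norm g)\<^sup>2)"
      using nn_integral_local_energy_le[OF g dr(5,6)] by (simp only: const)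
  qed
  have norms: "bergman_norm f \<ge> 0" "bergman_norm g \<ge> 0"
    by (rule bergman_norm_nonneg)+
  have [measurable]: "a \<in> borel_measurable borel" "b \<in> borel_measurable borel"
    unfolding a_def[abs_def] b_def[abs_def] by measurable
  have "(\<integral>\<^sup>+w. ennreal (a w) * ennreal (b w) \<partial>lborel)\<^sup>2
      \<le> (\<integral>\<^sup>+w. (ennreal (a w))\<^sup>2 \<partial>lborel) * (\<integral>\<^sup>+w. (ennreal (b w))\<^sup>2 \<partial>lborel)"
    by (rule Cauchy_Schwarz_nn_integral) measurable
  also have "\<dots> \<le> ennreal (pi\<^sup>2 / d\<^sup>2 * (bergman_norm f)\<^sup>2) * ennreal (pi\<^sup>2 / d\<^sup>2 * (bergman_norm g)\<^sup>2)"
    by (intro mult_mono sq) auto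
  also have "\<dots> = ennreal ((pi\<^sup>2 / d\<^sup>2 * bergman_norm f * bergman_norm g)\<^sup>2)"
    by (subst ennreal_mult[symmetric]) (auto simp: power2_eq_square mult_ac)
  finally have cs: "(\<integral>\<^sup>+w. ennreal (a w) * ennreal (b w) \<partial>lborel)
      \<le> ennreal (pi\<^sup>2 / d\<^sup>2 * bergman_norm f * bergman_norm g)"
    by (rule ennreal_le_of_power2_le) (use norms in auto)
  \<comment> \<open>The averaging: the constant on the left is the lower bound for the integral of the kernel.\<close>
  have "ennreal (pi * d\<^sup>2 / 16) * (\<integral>\<^sup>+u. h u \<partial>N) = (\<integral>\<^sup>+u. h u * ennreal (pi * d\<^sup>2 / 16) \<partial>N)"
    by (simp add: nn_integral_multc mult.commute)
  also have "\<dots> \<le> (\<integral>\<^sup>+u. h u * (\<integral>\<^sup>+w. whitney_kernel d w u \<partial>lborel) \<partial>N)"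
    using space dr by (intro nn_integral_mono mult_left_mono nn_integral_whitney_kernel_ge) auto
  also have "\<dots> = (\<integral>\<^sup>+u. \<integral>\<^sup>+w. h u * whitney_kernel d w u \<partial>lborel \<partial>N)"
    by (intro nn_integral_cong nn_integral_cmult[symmetric] borel_measurable_whitney_kernel) auto
  also have "\<dots> = (\<integral>\<^sup>+w. \<integral>\<^sup>+u. h u * whitney_kernel d w u \<partial>N \<partial>lborel)"
    by (rule Fubini'[symmetric]) (simp add: split_beta')
  also have "\<dots> \<le> (\<integral>\<^sup>+w. ennreal c * (ennreal (a w) * ennreal (b w)) \<partial>lborel)"
    by (intro nn_integral_mono inner)
  also have "\<dots> = ennreal c * (\<integral>\<^sup>+w. ennreal (a w) * ennreal (b w) \<partial>lborel)"
    by (intro nn_integral_cmult) measurable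
  also have "\<dots> \<le> ennreal c * ennreal (pi\<^sup>2 / d\<^sup>2 * bergman_norm f * bergman_norm g)"
    by (intro mult_left_mono cs) auto
  also have "\<dots> = ennreal (c * (pi\<^sup>2 / d\<^sup>2 * bergman_norm f * bergman_norm g))"
    using c norms by (subst ennreal_mult) auto
  finally have "ennreal (pi * d\<^sup>2 / 16) * (\<integral>\<^sup>+u. h u \<partial>N)
      \<le> ennreal (c * (pi\<^sup>2 / d\<^sup>2 * bergman_norm f * bergman_norm g))" .
  then have "ennreal (16 / (pi * d\<^sup>2)) * (ennreal (pi * d\<^sup>2 / 16) * (\<integral>\<^sup>+u. h u \<partial>N))
      \<le> ennreal (16 / (pi * d\<^sup>2)) * ennreal (c * (pi\<^sup>2 / d\<^sup>2 * bergman_norm f * bergman_norm g))"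
    by (rule mult_left_mono) simp
  also have "ennreal (16 / (pi * d\<^sup>2)) * (ennreal (pi * d\<^sup>2 / 16) * (\<integral>\<^sup>+u. h u \<partial>N)) = (\<integral>\<^sup>+u. h u \<partial>N)"
    using dr by (simp add: mult.assoc[symmetric] ennreal_mult[symmetric])
  also have "ennreal (16 / (pi * d\<^sup>2)) * ennreal (c * (pi\<^sup>2 / d\<^sup>2 * bergman_norm f * bergman_norm g))
      = ennreal (16 / (pi * d\<^sup>2) * (c * (pi\<^sup>2 / d\<^sup>2 * bergman_norm f * bergman_norm g)))"
    using c norms by (subst ennreal_mult) auto
  also have "16 / (pi * d\<^sup>2) * (c * (pi\<^sup>2 / d\<^sup>2 * bergman_norm f * bergman_norm g))
      = (16 / (pi * d\<^sup>2) * (1 / (pi * d\<^sup>2)) * (pi\<^sup>2 / d\<^sup>2)) * (fact l * fact j * B * bergman_norm f * bergman_norm g)"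
  proof -
    have "c = 1 / (pi * d\<^sup>2) * (fact l * fact j * B)"
      by (simp add: c_def)
    then show ?thesis
      by (simp only: mult_ac)
  qed
  also have "16 / (pi * d\<^sup>2) * (1 / (pi * d\<^sup>2)) * (pi\<^sup>2 / d\<^sup>2) = 16 / d ^ 6"
    by (simp add: power2_eq_square eval_nat_numeral)
  also have "16 / d ^ 6 = 4 ^ 8 / (1 - p) ^ 6"
    by (simp add: d_def power_divide)
  finally show ?thesis
    by (simp add: h_def mult.assoc)
qed

section \<open>Integration against complex measures on the disk\<close>

lemma sets_disk_measures [simp]:
  "sets (variation_measure \<mu>) = borel_disk" "sets (positive_part \<nu>) = borel_disk"
proof -
  have sub: "borel_disk \<subseteq> Pow unit_disk"
    by (auto simp: sets_restrict_space)
  show "sets (variation_measure \<mu>) = borel_disk" "sets (positive_part \<nu>) = borel_disk"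
    by (simp_all only: variation_measure_def positive_part_def sets_measure_of[OF sub]
        sigma_algebra.sigma_sets_eq[OF sigma_algebra_borel_disk])
qed

text \<open>
  The closed disks of radius \<open>1 - 1 / (n + 1)\<close> are compact and exhaust the unit disk. The property is
  needed for Tonelli, since the total variation may be infinite.
\<close>

lemma sigma_finite_variation_measure:
  assumes "disk_measure \<mu>"
  shows "sigma_finite_measure (variation_measure \<mu>)"
proof
  define K where "K n = cball (0::complex) (1 - 1 / real (Suc n))" for n
  have K: "compact (K n)" "K n \<subseteq> unit_disk" for n
  proof -
    have "1 - 1 / real (Suc n) < 1"
      by simp
    then show "compact (K n)" "K n \<subseteq> unit_disk"
      unfolding K_def by (simp_all add: cball_subset_ball_iff)
  qed
  have "K n \<in> borel_disk" for n
    using K(2)[of n] by (subst sets_restrict_space_iff) (auto simp: K_def)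
  moreover have "emeasure (variation_measure \<mu>) (K n) \<noteq> \<infinity>" for n
    using assms K[of n] \<open>K n \<in> borel_disk\<close>
    by (auto simp: emeasure_variation_measure disk_measure_def less_top)
  moreover have "\<Union>(range K) = unit_disk"
  proof
    show "\<Union>(range K) \<subseteq> unit_disk"
      using K by blast
    show "unit_disk \<subseteq> \<Union>(range K)"
    proof
      fix z :: complex assume "z \<in> unit_disk"
      then obtain n where "inverse (real (Suc n)) < 1 - norm z"
        using reals_Archimedean[of "1 - norm z"] by auto
      then have "z \<in> K n"
        by (simp add: K_def inverse_eq_divide)
      then show "z \<in> \<Union>(range K)"
        by blast
    qed
  qed
  ultimately show "\<exists>A. countable A \<and> A \<subseteq> sets (variation_measure \<mu>) \<and>
      \<Union>A = space (variation_measure \<mu>) \<and> (\<forall>a\<in>A. emeasure (variation_measure \<mu>) a \<noteq> \<infinity>)"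
    by (intro exI[of _ "range K"]) (auto simp: space_borel_disk)
qed

text \<open>
  The four parts in the Jordan decompositions are instances with \<open>T\<close> one of \<open>Re\<close>, \<open>- Re\<close>,
  \<open>Im\<close>, \<open>- Im\<close>. A single set is a partition, so its \<open>T\<close>-value is at most its variation.
\<close>

lemma positive_part_le_variation_measure:
  assumes \<mu>: "disk_measure \<mu>" and T: "bounded_linear T" "\<And>z. T z \<le> norm z"
  shows "positive_part (\<lambda>A. T (\<mu> A)) \<le> variation_measure \<mu>"
proof -
  have add: "locally_additive (\<lambda>A. T (\<mu> A))"
    using \<mu> bounded_linear.sums[OF T(1)] by (simp add: disk_measure_def locally_additive_def)
  have "upper_variation (\<lambda>A. T (\<mu> A)) E \<le> variation \<mu> E" for E
    unfolding upper_variation_def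
  proof (rule SUP_least)
    fix A assume A: "A \<in> {A \<in> local_sets. A \<subseteq> E}"
    have "ennreal (T (\<mu> A)) \<le> (\<Sum>X\<in>{A}. ennreal (norm (\<mu> X)))"
      by (simp add: T(2) ennreal_leI)
    also have "\<dots> \<le> variation \<mu> E"
      unfolding variation_def using A by (intro SUP_upper) auto
    finally show "ennreal (T (\<mu> A)) \<le> variation \<mu> E" .
  qed
  then show ?thesis
    by (simp add: le_measure emeasure_variation_measure[OF \<mu>] emeasure_positive_part[OF add])
qed

lemma Jordan_parts_le_variation_measure:
  assumes "disk_measure \<mu>"
  shows "positive_part (\<lambda>A. Re (\<mu> A)) \<le> variation_measure \<mu>"
    "positive_part (\<lambda>A. - Re (\<mu> A)) \<le> variation_measure \<mu>"
    "positive_part (\<lambda>A. Im (\<mu> A)) \<le> variation_measure \<mu>"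
    "positive_part (\<lambda>A. - Im (\<mu> A)) \<le> variation_measure \<mu>"
  using abs_Re_le_cmod abs_Im_le_cmod
  by (auto intro!: positive_part_le_variation_measure[OF assms] bounded_linear_Re bounded_linear_Im
      bounded_linear_minus simp: abs_le_iff)

lemma integrable_mono_measure:
  fixes h :: "'a \<Rightarrow> 'b::{banach, second_countable_topology}"
  assumes "integrable N h" "sets M = sets N" "M \<le> N"
  shows "integrable M h" "ennreal (norm (integral\<^sup>L M h)) \<le> (\<integral>\<^sup>+x. norm (h x) \<partial>N)"
proof -
  have le: "(\<integral>\<^sup>+x. norm (h x) \<partial>M) \<le> (\<integral>\<^sup>+x. norm (h x) \<partial>N)"
    by (rule nn_integral_mono_measure) fact+
  then show *: "integrable M h"
    using assms measurable_cong_sets[OF assms(2) refl, of borel]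
    by (auto simp: integrable_iff_bounded intro: le_less_trans)
  show "ennreal (norm (integral\<^sup>L M h)) \<le> (\<integral>\<^sup>+x. norm (h x) \<partial>N)"
    using integral_norm_bound_ennreal[OF *] le by (rule order_trans)
qed

text \<open>
  Each of the four Jordan parts is dominated by the variation, hence the factor 4.
\<close>

lemma norm_complex_integral_le:
  assumes \<mu>: "disk_measure \<mu>" and h: "integrable (variation_measure \<mu>) h"
    and le: "(\<integral>\<^sup>+z. norm (h z) \<partial>variation_measure \<mu>) \<le> ennreal c" and c: "0 \<le> c"
  shows "norm (complex_integral \<mu> h) \<le> 4 * c"
proof -
  have *: "norm (integral\<^sup>L M h) \<le> c" if "M \<le> variation_measure \<mu>" "sets M = borel_disk" for M
    using order_trans[OF integrable_mono_measure(2)[OF h _ that(1)] le] that(2) c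
    by (simp add: ennreal_le_iff)
  note J = Jordan_parts_le_variation_measure[OF \<mu>, THEN *, OF sets_disk_measures(2)]
  have tri: "norm (x1 - x2 + \<i> * (x3 - x4)) \<le> norm x1 + norm x2 + (norm x3 + norm x4)"
    for x1 x2 x3 x4 :: complex
    using norm_triangle_ineq4[of x1 x2] norm_triangle_ineq4[of x3 x4]
    by (intro norm_triangle_le add_mono) (auto simp: norm_mult)
  show ?thesis
    unfolding complex_integral_def by (rule order_trans[OF tri]) (use J in linarith)
qed

lemma complex_integral_cong:
  assumes "\<And>z. norm z < 1 \<Longrightarrow> h z = h' z"
  shows "complex_integral \<mu> h = complex_integral \<mu> h'"
proof -
  have "integral\<^sup>L (positive_part \<nu>) h = integral\<^sup>L (positive_part \<nu>) h'" for \<nu>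
    by (rule Bochner_Integration.integral_cong) (use assms in \<open>auto simp: space_borel_disk\<close>)
  then show ?thesis
    by (simp add: complex_integral_def)
qed

lemma complex_integral_linear:
  assumes \<mu>: "disk_measure \<mu>" and h: "integrable (variation_measure \<mu>) h"
    "integrable (variation_measure \<mu>) h'"
  shows "complex_integral \<mu> (\<lambda>z. a * h z + b * h' z)
    = a * complex_integral \<mu> h + b * complex_integral \<mu> h'"
proof -
  have *: "integral\<^sup>L M (\<lambda>z. a * h z + b * h' z) = a * integral\<^sup>L M h + b * integral\<^sup>L M h'"
    if "M \<le> variation_measure \<mu>" "sets M = borel_disk" for M
    using integrable_mono_measure(1)[OF h(1) _ that(1)] integrable_mono_measure(1)[OF h(2) _ that(1)]
    by (simp add: that(2))
  note J = Jordan_parts_le_variation_measure[OF \<mu>, THEN *, OF sets_disk_measures(2)]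
  show ?thesis
    unfolding complex_integral_def J by (simp add: algebra_simps)
qed

section \<open>Boundedness of the sesquilinear form\<close>

lemma higher_deriv_linear_combination:
  assumes "f holomorphic_on S" "g holomorphic_on S" "open S" "z \<in> S"
  shows "(deriv ^^ n) (\<lambda>z. a * f z + b * g z) z = a * (deriv ^^ n) f z + b * (deriv ^^ n) g z"
  using assms
  by (simp add: higher_deriv_add[where S=S] higher_deriv_cmult[where A=S] holomorphic_intros)

text \<open>
  Here \<open>2 * k = l + j\<close> makes the real exponents in the Carleson supremum natural numbers.
\<close>

lemma carleson_sup_bound:
  assumes \<mu>: "\<mu> \<in> carleson_class p k" and p: "0 < p" and k: "k = (real l + real j) / 2"
    and w: "norm w < 1"
  shows "emeasure (variation_measure \<mu>) (ball w (1 / 2 * (1 - norm w)))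
    \<le> ennreal (enn2real (carleson_sup p k \<mu>) / (Gamma (k + 1))\<^sup>2 *
        (1 - norm w) ^ (l + j + 2) * p ^ (l + j))"
proof -
  define m where "m = 1 - norm w"
  have m: "m > 0"
    using w by (simp add: m_def)
  let ?D = "ball w (1 / 2 * (1 - norm w))"
  define q where "q = m ^ (l + j + 2) * p ^ (l + j) / (Gamma (k + 1))\<^sup>2"
  have G: "Gamma (k + 1) > 0"
    using k by (intro Gamma_real_pos) auto
  have q: "q > 0"
    using m p G by (simp add: q_def)
  have dm: "disk_measure \<mu>" and fin: "carleson_sup p k \<mu> < \<infinity>"
    using \<mu> by (auto simp: carleson_class_def)
  have "?D \<subseteq> unit_disk"
    by (rule ball_subset_unit_disk[OF w]) simp
  then have D: "?D \<in> borel_disk"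
    by (subst sets_restrict_space_iff) auto
  have "- 2 * (k + 1) = - real (l + j + 2)" "- 2 * k = - real (l + j)"
    by (simp_all add: k field_simps)
  then have "m powr (- 2 * (k + 1)) = inverse (m ^ (l + j + 2))" "p powr (- 2 * k) = inverse (p ^ (l + j))"
    using m p by (simp_all only: powr_minus powr_realpow)
  then have weight: "m powr (- 2 * (k + 1)) * (Gamma (k + 1))\<^sup>2 * p powr (- 2 * k) = 1 / q"
    by (simp add: q_def field_simps)
  have "variation \<mu> ?D * ennreal (1 / q) \<le> carleson_sup p k \<mu>"
    unfolding carleson_sup_def weight[symmetric] m_def using w by (intro SUP_upper) auto
  then have "variation \<mu> ?D * ennreal (1 / q) * ennreal q \<le> carleson_sup p k \<mu> * ennreal q"
    by (rule mult_right_mono) simp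
  also have "variation \<mu> ?D * ennreal (1 / q) * ennreal q = variation \<mu> ?D"
    using q by (simp add: mult.assoc ennreal_mult[symmetric])
  also have "carleson_sup p k \<mu> * ennreal q = ennreal (enn2real (carleson_sup p k \<mu>) * q)"
    using fin q by (simp add: ennreal_mult)
  finally show ?thesis
    unfolding emeasure_variation_measure[OF dm D] by (simp add: q_def m_def mult_ac)
qed

text \<open>
  The powers of \<open>p\<close> cancel because \<open>(k - l) + (k - j) = 0\<close>.
\<close>

lemma sqrt_M_const_product:
  assumes "0 < p" and k: "k = (real l + real j) / 2"
  shows "sqrt (M_const p (real l) k) * sqrt (M_const p (real j) k)
    = fact l * fact j / (Gamma (k + 1))\<^sup>2"
proof -
  have "Gamma (real l + 1) = fact l" "Gamma (real j + 1) = fact j"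
    using Gamma_fact[of l, where 'a=real] Gamma_fact[of j, where 'a=real]
    by (simp_all add: add.commute)
  moreover have "p powr (2 * (k - real l)) * p powr (2 * (k - real j)) = 1"
  proof -
    have "2 * (k - real l) + 2 * (k - real j) = 0"
      by (simp add: k field_simps)
    then show ?thesis
      using assms(1) by (simp add: powr_add[symmetric])
  qed
  ultimately have "M_const p (real l) k * M_const p (real j) k
      = (fact l * fact j / (Gamma (k + 1))\<^sup>2)\<^sup>2"
    unfolding M_const_def by (simp add: power_mult_distrib power_divide field_simps)
  then have "sqrt (M_const p (real l) k) * sqrt (M_const p (real j) k)
      = sqrt ((fact l * fact j / (Gamma (k + 1))\<^sup>2)\<^sup>2)"
    by (simp only: real_sqrt_mult[symmetric])
  also have "\<dots> = fact l * fact j / (Gamma (k + 1))\<^sup>2"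
    by (intro real_sqrt_unique) auto
  finally show ?thesis .
qed

theorem proposition6p8:
  fixes p :: real
  assumes "0 < p" and "p < 1"
  shows "\<exists>C>0. \<forall>(l::nat) (j::nat) (k::real) \<mu>.
    k = (real l + real j) / 2 \<longrightarrow> \<mu> \<in> carleson_class p k \<longrightarrow>
      (\<forall>f\<in>bergman_space. \<forall>g\<in>bergman_space.
         integrable (variation_measure \<mu>) (form_integrand l j f g)) \<and>
      sesquilinear_on_bergman (sesq_form \<mu> l j) \<and>
      bounded_on_bergman (sesq_form \<mu> l j) \<and>
      (\<forall>f\<in>bergman_space. \<forall>g\<in>bergman_space.
         norm (sesq_form \<mu> l j f g)
           \<le> C * sqrt (M_const p (real l) k) * sqrt (M_const p (real j) k)
               * enn2real (carleson_sup p k \<mu>) * bergman_norm f * bergman_norm g)"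
proof (intro exI[of _ "4 * (4 ^ 8 / (1 - p) ^ 6)"] conjI allI impI)
  define A where "A = 4 ^ 8 / (1 - p) ^ 6"
  have A: "A > 0"
    using assms by (simp add: A_def)
  then show "4 * (4 ^ 8 / (1 - p) ^ 6) > 0"
    by (simp add: A_def)
  fix l j :: nat and k :: real and \<mu>
  assume k: "k = (real l + real j) / 2" and \<mu>: "\<mu> \<in> carleson_class p k"
  have dm: "disk_measure \<mu>"
    using \<mu> by (simp add: carleson_class_def)
  define V where "V = enn2real (carleson_sup p k \<mu>)"
  define E where "E f g = A * fact l * fact j * (V / (Gamma (k + 1))\<^sup>2) * bergman_norm f * bergman_norm g"
    for f g
  have E0: "E f g \<ge> 0" for f g
    using A bergman_norm_nonneg unfolding E_def V_def by (intro mult_nonneg_nonneg divide_nonneg_nonneg) auto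
  have hol: "f holomorphic_on unit_disk" if "f \<in> bergman_space" for f
    using that by (simp add: bergman_space_def)
  have nn: "(\<integral>\<^sup>+z. norm (form_integrand l j f g z) \<partial>variation_measure \<mu>) \<le> ennreal (E f g)"
    if "f \<in> bergman_space" "g \<in> bergman_space" for f g
    unfolding E_def V_def A_def
    by (rule carleson_derivative_embedding[OF assms that])
      (use carleson_sup_bound[OF \<mu> assms(1) k] sigma_finite_variation_measure[OF dm] in auto)
  have int: "integrable (variation_measure \<mu>) (form_integrand l j f g)"
    if "f \<in> bergman_space" "g \<in> bergman_space" for f g
    using form_integrand_measurable[OF hol[OF that(1)] hol[OF that(2)]] le_less_trans[OF nn[OF that]]
    by (simp add: integrable_iff_bounded)
  then show "\<forall>f\<in>bergman_space. \<forall>g\<in>bergman_space.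
      integrable (variation_measure \<mu>) (form_integrand l j f g)"
    by blast
  have bound: "norm (sesq_form \<mu> l j f g) \<le> 4 * E f g"
    if "f \<in> bergman_space" "g \<in> bergman_space" for f g
    unfolding sesq_form_def by (rule norm_complex_integral_le[OF dm int nn E0]) fact+
  have "norm (sesq_form \<mu> l j f g)
      \<le> (4 * A * fact l * fact j * (V / (Gamma (k + 1))\<^sup>2)) * bergman_norm f * bergman_norm g"
    if "f \<in> bergman_space" "g \<in> bergman_space" for f g
    using bound[OF that] by (simp add: E_def mult_ac)
  then show "bounded_on_bergman (sesq_form \<mu> l j)"
    unfolding bounded_on_bergman_def by blast
  show "\<forall>f\<in>bergman_space. \<forall>g\<in>bergman_space. norm (sesq_form \<mu> l j f g)
      \<le> 4 * (4 ^ 8 / (1 - p) ^ 6) * sqrt (M_const p (real l) k) * sqrt (M_const p (real j) k)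
        * enn2real (carleson_sup p k \<mu>) * bergman_norm f * bergman_norm g"
  proof (intro ballI)
    fix f g assume fg: "f \<in> bergman_space" "g \<in> bergman_space"
    have "4 * E f g = 4 * A * (sqrt (M_const p (real l) k) * sqrt (M_const p (real j) k))
        * V * bergman_norm f * bergman_norm g"
      unfolding sqrt_M_const_product[OF assms(1) k] by (simp add: E_def)
    then show "norm (sesq_form \<mu> l j f g)
      \<le> 4 * (4 ^ 8 / (1 - p) ^ 6) * sqrt (M_const p (real l) k) * sqrt (M_const p (real j) k)
        * enn2real (carleson_sup p k \<mu>) * bergman_norm f * bergman_norm g"
      using bound[OF fg] by (simp add: A_def V_def mult.assoc)
  qed
  show "sesquilinear_on_bergman (sesq_form \<mu> l j)"
    unfolding sesquilinear_on_bergman_def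
  proof (intro conjI ballI allI)
    fix f1 f2 g a b
    assume fg: "f1 \<in> bergman_space" "f2 \<in> bergman_space" "g \<in> bergman_space"
    have "sesq_form \<mu> l j (\<lambda>z. a * f1 z + b * f2 z) g
        = complex_integral \<mu> (\<lambda>z. a * form_integrand l j f1 g z + b * form_integrand l j f2 g z)"
      unfolding sesq_form_def
      by (rule complex_integral_cong)
        (simp add: form_integrand_def algebra_simps
          higher_deriv_linear_combination[OF hol[OF fg(1)] hol[OF fg(2)]])
    then show "sesq_form \<mu> l j (\<lambda>z. a * f1 z + b * f2 z) g
        = a * sesq_form \<mu> l j f1 g + b * sesq_form \<mu> l j f2 g"
      using int fg by (simp add: complex_integral_linear[OF dm] sesq_form_def)
  next
    fix f g1 g2 a b
    assume fg: "f \<in> bergman_space" "g1 \<in> bergman_space" "g2 \<in> bergman_space"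
    have "sesq_form \<mu> l j f (\<lambda>z. a * g1 z + b * g2 z)
        = complex_integral \<mu> (\<lambda>z. cnj a * form_integrand l j f g1 z + cnj b * form_integrand l j f g2 z)"
      unfolding sesq_form_def
      by (rule complex_integral_cong)
        (simp add: form_integrand_def algebra_simps
          higher_deriv_linear_combination[OF hol[OF fg(2)] hol[OF fg(3)]])
    then show "sesq_form \<mu> l j f (\<lambda>z. a * g1 z + b * g2 z)
        = cnj a * sesq_form \<mu> l j f g1 + cnj b * sesq_form \<mu> l j f g2"
      using int fg by (simp add: complex_integral_linear[OF dm] sesq_form_def)
  qed
qed

end
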